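(* For $p>1$ let $u_p$ be the positive solution of $-u''=u^p$ in $I=(-1,1)$, $u>0$ in $I$, $u(\pm1)=0$, and let $\alpha_1(p)$ be the first eigenvalue of the linearized operator $L_{u_p}=-\frac{d^2}{dt^2}-p\,u_p^{p-1}$ in $I$ with Dirichlet boundary conditions. Then: (1) $\lim_{p\to+\infty}\|u_p\|_\infty=1$; (2) as $p\to+\infty$, $u_p\to 2G(\cdot,0)$ in $C^0([-1,1])$ and in $C^1_{loc}([-1,1]\setminus\{0\})$, where $G$ is the Green's function of $-\frac{d^2}{dt^2}$ in $I$ with Dirichlet boundary conditions, i.e. $G(t,\tau)=-\frac{(\tau+1)(t-1)}{2}$ if $t>\tau$ and $G(t,\tau)=\frac{(t+1)(1-\tau)}{2}$ if $t\le\tau$; (3) $\|u_p\|_\infty^{p+1}=\frac p2\,(1+o_p(1))$ as $p\to+\infty$; (4) setting $\mu_p:=(p\|u_p\|_\infty^{p-1})^{-1/2}$ and $\tilde u_p(s)=p\,\frac{u_p(\mu_p s)-u_p(0)}{u_p(0)}$ for $s\in[-\frac1{\mu_p},\frac1{\mu_p}]$, one has $\tilde u_p\to W$ in $C^1_{loc}(\mathbb{R})$ as $p\to+\infty$, where $W(s)=\log\frac{4e^{\sqrt2 s}}{(1+e^{\sqrt2 s})^2}$, $s\in\mathbb{R}$, is the solution of $-W''=e^W$ in $\mathbb{R}$, $W'(0)=0$, $W(0)=0$; (5) $\alpha_1(p)=-\frac14\,p^2\,(1+o_p(1))$ as $p\to+\infty$.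
   Context: For every $p>1$ the boundary value problem has a unique positive solution $u_p$; it is even and decreasing on $[0,1]$, so $\|u_p\|_\infty=u_p(0)$. The symbol $o_p(1)$ denotes a quantity tending to $0$ in the indicated limit of $p$. Convergence in $C^1_{loc}([-1,1]\setminus\{0\})$ means $C^1$ convergence on every compact subset of $[-1,1]\setminus\{0\}$, e.g. on $[-1,-\delta]\cup[\delta,1]$ for every $\delta\in(0,1)$. Convergence in $C^1_{loc}(\mathbb{R})$ means $C^1$ convergence on every compact subset of $\mathbb{R}$ (each compact set is contained in $[-1/\mu_p,1/\mu_p]$ for $p$ large). *)

theory Defs
  imports "HOL-Analysis.Analysis"
begin

text \<open>
  Functions on the closed interval are total functions of type \<^typ>\<open>real \<Rightarrow> real\<close> whose values
  outside \<open>[-1,1]\<close> are irrelevant.  Classical solutions are taken in \<open>C\<^sup>0([-1,1]) \<inter> C\<^sup>2(-1,1)\<close>;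
  continuity of the second derivative is not required because it follows from each of the
  equations below.
\<close>

definition twice_differentiable_on :: "(real \<Rightarrow> real) \<Rightarrow> real set \<Rightarrow> bool" where
  "twice_differentiable_on f S \<longleftrightarrow>
     (\<forall>t\<in>S. f differentiable (at t) \<and> deriv f differentiable (at t))"

definition dirichlet_function :: "(real \<Rightarrow> real) \<Rightarrow> bool" where
  "dirichlet_function f \<longleftrightarrow>
     continuous_on {-1..1} f \<and> twice_differentiable_on f {-1<..<1} \<and> f (-1) = 0 \<and> f 1 = 0"

definition positive_solution :: "real \<Rightarrow> (real \<Rightarrow> real) \<Rightarrow> bool" where
  "positive_solution p u \<longleftrightarrow>
     dirichlet_function u \<and>
     (\<forall>t\<in>{-1<..<1}. u t > 0 \<and> - deriv (deriv u) t = u t powr p)"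

definition sup_norm :: "(real \<Rightarrow> real) \<Rightarrow> real" where
  "sup_norm f = (SUP t\<in>{-1..1}. \<bar>f t\<bar>)"

definition linearized_operator :: "real \<Rightarrow> (real \<Rightarrow> real) \<Rightarrow> (real \<Rightarrow> real) \<Rightarrow> real \<Rightarrow> real" where
  "linearized_operator p u \<phi> t = - deriv (deriv \<phi>) t - p * u t powr (p - 1) * \<phi> t"

definition dirichlet_eigenvalue :: "((real \<Rightarrow> real) \<Rightarrow> real \<Rightarrow> real) \<Rightarrow> real \<Rightarrow> bool" where
  "dirichlet_eigenvalue L \<alpha> \<longleftrightarrow>
     (\<exists>\<phi>. dirichlet_function \<phi> \<and> (\<exists>t\<in>{-1<..<1}. \<phi> t \<noteq> 0) \<and>
          (\<forall>t\<in>{-1<..<1}. L \<phi> t = \<alpha> * \<phi> t))"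

definition first_dirichlet_eigenvalue :: "((real \<Rightarrow> real) \<Rightarrow> real \<Rightarrow> real) \<Rightarrow> real \<Rightarrow> bool" where
  "first_dirichlet_eigenvalue L \<alpha> \<longleftrightarrow>
     dirichlet_eigenvalue L \<alpha> \<and> (\<forall>\<beta>. dirichlet_eigenvalue L \<beta> \<longrightarrow> \<alpha> \<le> \<beta>)"

definition green :: "real \<Rightarrow> real \<Rightarrow> real" where
  "green t \<tau> = (if t > \<tau> then - ((\<tau> + 1) * (t - 1) / 2) else (t + 1) * (1 - \<tau>) / 2)"

text \<open>
  Derivatives are taken relative to the domain, hence one-sided at the end points of a closed
  interval; the library's \<^const>\<open>C1_differentiable_on\<close> asks for two-sided derivatives there.
\<close>

definition C1_on :: "real set \<Rightarrow> (real \<Rightarrow> real) \<Rightarrow> bool" where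
  "C1_on S f \<longleftrightarrow>
     f differentiable_on S \<and> continuous_on S (\<lambda>t. vector_derivative f (at t within S))"

text \<open>
  Convergence in \<open>C\<^sup>1\<^sub>l\<^sub>o\<^sub>c(\<Omega>)\<close> of functions \<open>f i\<close> defined on domains \<open>D i\<close> that
  may vary with \<open>i\<close> and need only contain a given compact subset of \<open>\<Omega>\<close> eventually.
\<close>

definition C1_loc_tendsto ::
    "real set \<Rightarrow> ('i \<Rightarrow> real set) \<Rightarrow> ('i \<Rightarrow> real \<Rightarrow> real) \<Rightarrow> (real \<Rightarrow> real) \<Rightarrow> 'i filter \<Rightarrow> bool" where
  "C1_loc_tendsto \<Omega> D f g F \<longleftrightarrow>
     C1_on \<Omega> g \<and>
     (\<forall>K. compact K \<and> K \<subseteq> \<Omega> \<longrightarrow>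
        (\<forall>\<^sub>F i in F. K \<subseteq> D i \<and> C1_on (D i) (f i)) \<and>
        uniform_limit K f g F \<and>
        uniform_limit K (\<lambda>i t. vector_derivative (f i) (at t within D i))
                        (\<lambda>t. vector_derivative g (at t within \<Omega>)) F)"

definition blowup_scale :: "real \<Rightarrow> (real \<Rightarrow> real) \<Rightarrow> real" where
  "blowup_scale p u = (p * sup_norm u powr (p - 1)) powr (- 1 / 2)"

definition rescaled :: "real \<Rightarrow> (real \<Rightarrow> real) \<Rightarrow> real \<Rightarrow> real" where
  "rescaled p u s = p * (u (blowup_scale p u * s) - u 0) / u 0"

definition profile :: "real \<Rightarrow> real" where
  "profile s = ln (4 * exp (sqrt 2 * s) / (1 + exp (sqrt 2 * s))\<^sup>2)"

definition liouville_solution :: "(real \<Rightarrow> real) \<Rightarrow> bool" where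
  "liouville_solution V \<longleftrightarrow>
     twice_differentiable_on V UNIV \<and> (\<forall>s. - deriv (deriv V) s = exp (V s)) \<and>
     deriv V 0 = 0 \<and> V 0 = 0"

end

theory Submission
  imports Defs "HOL-Real_Asymp.Real_Asymp"
begin

text \<open>
  Write \<open>k = (p + 1) / 2\<close>, \<open>M = u 0\<close>, \<open>a = - u' 1\<close> and \<open>c = k a / M\<close>.  By uniqueness for the initial
  value problem at a maximum point, \<open>u\<close> is even.  The energy identity shows that \<open>w = - u' / a\<close>
  satisfies \<open>w' = (k a / u) (1 - w\<^sup>2)\<close>, i.e. \<open>artanh w\<close> has derivative \<open>k a / u\<close>.  Since \<open>u \<le> M\<close>, this gives
  \<open>w t \<ge> tanh (c t)\<close>, which integrates to \<open>k \<le> c \<le> k + ln 2\<close>; then \<open>u \<ge> M (1 - 2 t)\<close> on \<open>[0,t]\<close> gives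
  \<open>w t \<le> tanh (c t / (1 - 2 t))\<close>.  As \<open>M\<^sup>p\<^sup>-\<^sup>1 = c\<^sup>2 / k\<close>, all asymptotics of \<open>u\<close> follow.

  For the eigenvalue, \<open>1 / cosh (c t)\<close> is a positive supersolution and gives
  \<open>\<alpha>\<^sub>1 \<ge> - c\<^sup>2 (1 + 2 / k)\<close>, while \<open>u\<^sup>k\<close> is a subsolution and gives, by a shooting argument,
  \<open>\<alpha>\<^sub>1 \<le> - (k - 1) c\<^sup>2 / k\<close>.
\<close>

section \<open>Second-order differential inequalities\<close>

text \<open>All estimates are explicit and hold for each fixed p > 1; limits in p are taken only in
  the final theorem. The bound k <= c comes from |u'| <= a, which forces M <= a. The two comparison
  functions for the eigenvalue are asymptotically one object: on [0,1], 1 - w^2 = (u/M)^(p+1), so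
  (u/M)^k = sqrt (1 - w^2), which is close to sech (c t) once w is close to tanh (c t). The latter
  solves f'' + 2 c^2 sech^2 (c t) f = c^2 f, the ground state of a Poeschl-Teller potential, and c ~
  k ~ p/2 is the origin of the constant 1/4 in the eigenvalue asymptotics. The obstacle in the upper
  bound is that the first eigenvalue is given only as the least among those with a classical
  eigenfunction. A test function alone then proves nothing: an actual eigenvalue below the bound has
  to be produced, and this is the task of the shooting argument.\<close>

lemma antiderivative_on_reals:
  fixes g :: "real \<Rightarrow> real"
  assumes "continuous_on UNIV g"
  shows "\<exists>G. G 0 = c \<and> (\<forall>x. (G has_real_derivative g x) (at x))"
proof -
  have "\<exists>F. \<forall>x::real. -\<infinity> < ereal x \<longrightarrow> ereal x < \<infinity> \<longrightarrow> (F has_vector_derivative g x) (at x)"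
    by (rule einterval_antiderivative) (use assms in \<open>auto simp: continuous_on_eq_continuous_at\<close>)
  then obtain F where F: "\<And>x. (F has_real_derivative g x) (at x)"
    by (auto simp: has_real_derivative_iff_has_vector_derivative)
  show ?thesis
    by (rule exI[of _ "\<lambda>x. F x - F 0 + c"]) (auto intro!: derivative_eq_intros F)
qed

lemma has_real_derivative_reflect:
  fixes f :: "real \<Rightarrow> real"
  assumes "(f has_real_derivative D) (at (- x))"
  shows "((\<lambda>x. f (- x)) has_real_derivative - D) (at x)"
  using assms by (simp add: DERIV_mirror)

text \<open>This stands in for integrating an inequality between derivatives; the integrated bounds
  below compare increments in this form.\<close>

lemma derivative_mono_imp_le:
  fixes f g :: "real \<Rightarrow> real"
  assumes "a \<le> b"
    and "\<And>x. x \<in> {a..b} \<Longrightarrow> (f has_real_derivative f' x) (at x)"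
    and "\<And>x. x \<in> {a..b} \<Longrightarrow> (g has_real_derivative g' x) (at x)"
    and "\<And>x. x \<in> {a..b} \<Longrightarrow> f' x \<le> g' x"
  shows "f b - f a \<le> g b - g a"
proof -
  have "(\<lambda>x. g x - f x) a \<le> (\<lambda>x. g x - f x) b"
    by (rule DERIV_nonneg_imp_nondecreasing[OF assms(1)])
      (use assms in \<open>force intro!: exI derivative_eq_intros\<close>)
  then show ?thesis by simp
qed

text \<open>The energy d^2 + d1^2 grows at rate at most 2 + L, up to the source e^2. The case e = 0
  yields uniqueness; e > 0 yields Lipschitz dependence on the shooting parameter.\<close>

lemma second_order_gronwall:
  fixes d d1 d2 :: "real \<Rightarrow> real"
  assumes t: "0 \<le> t" and L: "0 \<le> L" and e: "0 \<le> e"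
    and d: "\<And>x. x \<in> {0..t} \<Longrightarrow> (d has_real_derivative d1 x) (at x)"
    and d1: "\<And>x. x \<in> {0..t} \<Longrightarrow> (d1 has_real_derivative d2 x) (at x)"
    and d2: "\<And>x. x \<in> {0..t} \<Longrightarrow> \<bar>d2 x\<bar> \<le> L * \<bar>d x\<bar> + e"
  shows "(d t)\<^sup>2 + (d1 t)\<^sup>2 \<le> ((d 0)\<^sup>2 + (d1 0)\<^sup>2 + e\<^sup>2 * t) * exp ((2 + L) * t)"
proof -
  define F where "F x = ((d x)\<^sup>2 + (d1 x)\<^sup>2) * exp (- (2 + L) * x)" for x
  define F' where "F' x = (2 * d x * d1 x + 2 * d1 x * d2 x - (2 + L) * ((d x)\<^sup>2 + (d1 x)\<^sup>2)) * exp (- (2 + L) * x)" for x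
  have "F t - F 0 \<le> e\<^sup>2 * t - e\<^sup>2 * 0"
  proof (rule derivative_mono_imp_le[OF t])
    fix x assume x: "x \<in> {0..t}"
    show "(F has_real_derivative F' x) (at x)"
      unfolding F_def F'_def
      by (auto intro!: derivative_eq_intros d[OF x] d1[OF x] simp: algebra_simps)
    show "((\<lambda>x. e\<^sup>2 * x) has_real_derivative e\<^sup>2) (at x)"
      by (auto intro!: derivative_eq_intros)
    have "2 * d x * d1 x \<le> (d x)\<^sup>2 + (d1 x)\<^sup>2"
      using sum_squares_bound[of "d x" "d1 x"] by simp
    moreover have "2 * d1 x * d2 x \<le> 2 * \<bar>d1 x\<bar> * (L * \<bar>d x\<bar> + e)"
    proof -
      have "2 * d1 x * d2 x \<le> 2 * (\<bar>d1 x\<bar> * \<bar>d2 x\<bar>)"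
        by (metis abs_ge_self abs_mult mult.assoc mult_left_mono zero_le_numeral)
      also have "\<dots> \<le> 2 * (\<bar>d1 x\<bar> * (L * \<bar>d x\<bar> + e))"
        by (intro mult_left_mono d2[OF x]) auto
      finally show ?thesis by simp
    qed
    moreover have "2 * \<bar>d1 x\<bar> * e \<le> (d1 x)\<^sup>2 + e\<^sup>2"
      using sum_squares_bound[of "\<bar>d1 x\<bar>" e] by simp
    moreover have "L * (2 * \<bar>d1 x\<bar> * \<bar>d x\<bar>) \<le> L * ((d1 x)\<^sup>2 + (d x)\<^sup>2)"
      using sum_squares_bound[of "\<bar>d1 x\<bar>" "\<bar>d x\<bar>"] by (intro mult_left_mono L) simp
    ultimately have "2 * d x * d1 x + 2 * d1 x * d2 x - (2 + L) * ((d x)\<^sup>2 + (d1 x)\<^sup>2) \<le> e\<^sup>2 - (d x)\<^sup>2"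
      by (simp add: algebra_simps)
    then have *: "2 * d x * d1 x + 2 * d1 x * d2 x - (2 + L) * ((d x)\<^sup>2 + (d1 x)\<^sup>2) \<le> e\<^sup>2"
      by (smt (verit) zero_le_power2)
    have "F' x \<le> e\<^sup>2 * exp (- (2 + L) * x)"
      unfolding F'_def by (intro mult_right_mono *) simp
    also have "\<dots> \<le> e\<^sup>2 * 1"
      using L x by (intro mult_left_mono) (auto simp: mult_nonpos_nonneg)
    finally show "F' x \<le> e\<^sup>2" by simp
  qed
  then have "F t \<le> (d 0)\<^sup>2 + (d1 0)\<^sup>2 + e\<^sup>2 * t" by (simp add: F_def)
  then have "F t * exp ((2 + L) * t) \<le> ((d 0)\<^sup>2 + (d1 0)\<^sup>2 + e\<^sup>2 * t) * exp ((2 + L) * t)"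
    by (intro mult_right_mono) auto
  moreover have "F t * exp ((2 + L) * t) = (d t)\<^sup>2 + (d1 t)\<^sup>2"
    by (simp add: F_def mult.assoc flip: exp_add) (simp add: algebra_simps)
  ultimately show ?thesis by simp
qed

lemma second_order_unique_right:
  fixes d d1 d2 :: "real \<Rightarrow> real"
  assumes "0 \<le> t" "0 \<le> L"
    and "\<And>x. x \<in> {0..t} \<Longrightarrow> (d has_real_derivative d1 x) (at x)"
    and "\<And>x. x \<in> {0..t} \<Longrightarrow> (d1 has_real_derivative d2 x) (at x)"
    and "\<And>x. x \<in> {0..t} \<Longrightarrow> \<bar>d2 x\<bar> \<le> L * \<bar>d x\<bar>"
    and "d 0 = 0" "d1 0 = 0"
  shows "d t = 0"
proof -
  have "(d t)\<^sup>2 + (d1 t)\<^sup>2 \<le> 0"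
    using second_order_gronwall[of t L 0 d d1 d2] assms by simp
  then show ?thesis by (smt (verit) zero_le_power2 power2_less_eq_zero_iff)
qed

lemma second_order_unique:
  fixes d d1 d2 :: "real \<Rightarrow> real"
  assumes L: "0 \<le> L"
    and d: "\<And>x. \<bar>x\<bar> \<le> R \<Longrightarrow> (d has_real_derivative d1 x) (at x)"
    and d1: "\<And>x. \<bar>x\<bar> \<le> R \<Longrightarrow> (d1 has_real_derivative d2 x) (at x)"
    and d2: "\<And>x. \<bar>x\<bar> \<le> R \<Longrightarrow> \<bar>d2 x\<bar> \<le> L * \<bar>d x\<bar>"
    and "d 0 = 0" "d1 0 = 0" and t: "\<bar>t\<bar> \<le> R"
  shows "d t = 0"
proof (cases "0 \<le> t")
  case True
  then show ?thesis
    by (intro second_order_unique_right[of t L d d1 d2]) (use assms in auto)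
next
  case False
  have "d (- (- t)) = 0"
  proof (rule second_order_unique_right[of "- t" L "\<lambda>x. d (- x)" "\<lambda>x. - d1 (- x)" "\<lambda>x. d2 (- x)"])
    fix x assume x: "x \<in> {0..- t}"
    show "((\<lambda>x. d (- x)) has_real_derivative - d1 (- x)) (at x)"
      using x t by (intro has_real_derivative_reflect d) auto
    have "((\<lambda>x. d1 (- x)) has_real_derivative - d2 (- x)) (at x)"
      using x t by (intro has_real_derivative_reflect d1) auto
    from DERIV_minus[OF this] show "((\<lambda>x. - d1 (- x)) has_real_derivative d2 (- x)) (at x)"
      by simp
    show "\<bar>d2 (- x)\<bar> \<le> L * \<bar>d (- x)\<bar>" using x t by (intro d2) auto
  qed (use assms False in auto)
  then show ?thesis by simp
qed

text \<open>One step of Picard iteration: integrating from 0 raises the power by one and gains the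
  factor 1/(n+1) from which the factorial is built.\<close>

lemma antiderivative_power_bound_right:
  fixes G g :: "real \<Rightarrow> real"
  assumes x: "0 \<le> x" and G0: "G 0 = 0"
    and G: "\<And>y. y \<in> {0..x} \<Longrightarrow> (G has_real_derivative g y) (at y)"
    and g: "\<And>y. y \<in> {0..x} \<Longrightarrow> \<bar>g y\<bar> \<le> C * y ^ n"
  shows "\<bar>G x\<bar> \<le> C * x ^ Suc n / real (Suc n)"
proof -
  let ?P = "\<lambda>y. C * y ^ Suc n / real (Suc n)"
  have P: "(?P has_real_derivative C * y ^ n) (at y)" for y
    by (auto intro!: derivative_eq_intros simp del: power_Suc)
  have "G x - G 0 \<le> ?P x - ?P 0"
    by (rule derivative_mono_imp_le[OF x G P]) (use g in force)+
  moreover have "- G x - - G 0 \<le> ?P x - ?P 0"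
    by (rule derivative_mono_imp_le[OF x DERIV_minus[OF G] P]) (use g in force)+
  ultimately show ?thesis using G0 by (simp add: abs_le_iff)
qed

lemma antiderivative_power_bound:
  fixes G g :: "real \<Rightarrow> real"
  assumes x: "\<bar>x\<bar> \<le> R" and G0: "G 0 = 0"
    and G: "\<And>y. \<bar>y\<bar> \<le> R \<Longrightarrow> (G has_real_derivative g y) (at y)"
    and g: "\<And>y. \<bar>y\<bar> \<le> R \<Longrightarrow> \<bar>g y\<bar> \<le> C * \<bar>y\<bar> ^ n"
  shows "\<bar>G x\<bar> \<le> C * \<bar>x\<bar> ^ Suc n / real (Suc n)"
proof (cases "0 \<le> x")
  case True
  then show ?thesis
    using antiderivative_power_bound_right[of x G g C n] assms
    by (smt (verit) atLeastAtMost_iff)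
next
  case False
  have "\<bar>G (- (- x))\<bar> \<le> C * (- x) ^ Suc n / real (Suc n)"
  proof (rule antiderivative_power_bound_right[where g = "\<lambda>y. - g (- y)"])
    fix y assume y: "y \<in> {0..- x}"
    show "((\<lambda>y. G (- y)) has_real_derivative - g (- y)) (at y)"
      using x y by (intro has_real_derivative_reflect G) auto
    show "\<bar>- g (- y)\<bar> \<le> C * y ^ n"
      using x y g[of "- y"] by auto
  qed (use False G0 in auto)
  then show ?thesis using False by (simp add: abs_if)
qed

section \<open>Linear equations and shooting\<close>

text \<open>The solution is the Picard series whose terms satisfy f 0 = 1 and (f (n+1))'' = q f n;
  factorial bounds allow it to be differentiated twice term by term.\<close>

lemma linear_ode_exists:
  fixes q :: "real \<Rightarrow> real"
  assumes q: "continuous_on UNIV q" and Q: "\<And>x. \<bar>q x\<bar> \<le> Q"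
  shows "\<exists>y y1. y 0 = 1 \<and> y1 0 = 0 \<and>
    (\<forall>x\<in>{-1..1}. (y has_real_derivative y1 x) (at x) \<and>
                 (y1 has_real_derivative q x * y x) (at x))"
proof -
  \<comment> \<open>The antiderivative vanishing at 0, meaningful only for continuous arguments;
    hence the continuity facts for every iterate below.\<close>
  define A :: "(real \<Rightarrow> real) \<Rightarrow> real \<Rightarrow> real" where
    "A g = (SOME G. G 0 = 0 \<and> (\<forall>x. (G has_real_derivative g x) (at x)))" for g
  have A: "A g 0 = 0" "(A g has_real_derivative g x) (at x)" if "continuous_on UNIV g" for g x
    using someI_ex[OF antiderivative_on_reals[OF that, of 0]] unfolding A_def by blast+
  have contA: "continuous_on UNIV (A g)" if "continuous_on UNIV g" for g
    using A(2)[OF that] by (meson DERIV_continuous_on DERIV_subset UNIV_I subset_UNIV)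
  define f where "f n = ((\<lambda>h. A (A (\<lambda>x. q x * h x))) ^^ n) (\<lambda>_. 1)" for n
  \<comment> \<open>\<open>f1\<close> and \<open>f2\<close> are the first and second derivatives of
    the terms; the shift in \<open>f2 (Suc n) = q * f n\<close> is what makes the summed series
    solve the equation.\<close>
  define f1 where "f1 n = (case n of 0 \<Rightarrow> (\<lambda>_. 0) | Suc m \<Rightarrow> A (\<lambda>x. q x * f m x))" for n
  define f2 where "f2 n = (case n of 0 \<Rightarrow> (\<lambda>_. 0) | Suc m \<Rightarrow> (\<lambda>x. q x * f m x))" for n
  have f_0: "f 0 = (\<lambda>_. 1)" and f_Suc: "f (Suc n) = A (f1 (Suc n))" for n
    by (simp_all add: f_def f1_def)
  have f1_0: "f1 0 = (\<lambda>_. 0)" and f1_Suc: "f1 (Suc n) = A (f2 (Suc n))" for n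
    by (simp_all add: f1_def f2_def)
  have f2_0: "f2 0 = (\<lambda>_. 0)" and f2_Suc: "f2 (Suc n) = (\<lambda>x. q x * f n x)" for n
    by (simp_all add: f2_def)
  have contf: "continuous_on UNIV (f n)" for n
  proof (induction n)
    case 0
    then show ?case by (simp add: f_0)
  next
    case (Suc n)
    then show ?case
      unfolding f_Suc f1_Suc f2_Suc by (intro contA continuous_on_mult q)
  qed
  have contf2: "continuous_on UNIV (f2 (Suc n))" for n
    unfolding f2_Suc by (intro continuous_on_mult q contf)
  have contf1: "continuous_on UNIV (f1 (Suc n))" for n
    unfolding f1_Suc by (intro contA contf2)
  have df: "(f n has_real_derivative f1 n x) (at x)" for n x
    by (cases n) (auto simp: f_0 f1_0 f_Suc intro: A contf1)
  have df1: "(f1 n has_real_derivative f2 n x) (at x)" for n x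
    by (cases n) (auto simp: f1_0 f2_0 f1_Suc intro: A contf2)
  have Q0: "0 \<le> Q" using Q[of 0] by linarith
  have bound_f1: "\<bar>f1 (Suc n) x\<bar> \<le> Q * (2 * Q) ^ n / fact (Suc n) * \<bar>x\<bar> ^ Suc n"
    if f: "\<And>x. \<bar>x\<bar> \<le> 2 \<Longrightarrow> \<bar>f n x\<bar> \<le> (2 * Q) ^ n / fact n * \<bar>x\<bar> ^ n" and x: "\<bar>x\<bar> \<le> 2" for n x
  proof -
    have "\<bar>f1 (Suc n) x\<bar> \<le> (Q * (2 * Q) ^ n / fact n) * \<bar>x\<bar> ^ Suc n / real (Suc n)"
    proof (rule antiderivative_power_bound[OF x _ df1])
      show "f1 (Suc n) 0 = 0" unfolding f1_Suc by (intro A contf2)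
      fix y :: real assume y: "\<bar>y\<bar> \<le> 2"
      show "\<bar>f2 (Suc n) y\<bar> \<le> Q * (2 * Q) ^ n / fact n * \<bar>y\<bar> ^ n"
        using mult_mono[OF Q[of y] f[OF y]] Q0 by (simp add: f2_Suc abs_mult)
    qed
    then show ?thesis by (simp add: field_simps)
  qed
  \<comment> \<open>Each step integrates twice, but only one of the two gained factors is kept. The
    surplus |x|/(n+2) is estimated by 2, which turns Q into 2 Q.\<close>
  have bound_f: "\<bar>f n x\<bar> \<le> (2 * Q) ^ n / fact n * \<bar>x\<bar> ^ n" if x: "\<bar>x\<bar> \<le> 2" for n x
    using x
  proof (induction n arbitrary: x)
    case 0
    then show ?case by (simp add: f_0)
  next
    case (Suc n)
    define C where "C = Q * (2 * Q) ^ n / fact (Suc n)"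
    have C: "0 \<le> C" using Q0 by (simp add: C_def)
    have "\<bar>f (Suc n) x\<bar> \<le> C * \<bar>x\<bar> ^ Suc (Suc n) / real (Suc (Suc n))"
    proof (rule antiderivative_power_bound[OF Suc.prems _ df])
      show "f (Suc n) 0 = 0" unfolding f_Suc by (intro A contf1)
      show "\<bar>f1 (Suc n) y\<bar> \<le> C * \<bar>y\<bar> ^ Suc n" if "\<bar>y\<bar> \<le> 2" for y
        unfolding C_def using Suc.IH that by (rule bound_f1)
    qed
    also have "\<dots> \<le> C * \<bar>x\<bar> ^ Suc (Suc n)"
      using C divide_left_mono[of 1 "real (Suc (Suc n))" "C * \<bar>x\<bar> ^ Suc (Suc n)"] by simp
    also have "\<dots> = C * \<bar>x\<bar> ^ Suc n * \<bar>x\<bar>" by simp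
    also have "\<dots> \<le> C * \<bar>x\<bar> ^ Suc n * 2"
      using C Suc.prems by (intro mult_left_mono) auto
    also have "\<dots> = (2 * Q) ^ Suc n / fact (Suc n) * \<bar>x\<bar> ^ Suc n"
      by (simp add: C_def mult_ac)
    finally show ?case .
  qed
  have pow2: "\<bar>x\<bar> ^ n \<le> 2 ^ n" if "x \<in> {-2..2}" for x :: real and n
    using that by (intro power_mono) auto
  have sup_f: "norm (f n x) \<le> (4 * Q) ^ n / fact n" if x: "x \<in> {-2..2}" for n x
  proof -
    have "\<bar>f n x\<bar> \<le> (2 * Q) ^ n / fact n * \<bar>x\<bar> ^ n" using x by (intro bound_f) auto
    also have "\<dots> \<le> (2 * Q) ^ n / fact n * 2 ^ n"
      using Q0 by (intro mult_left_mono pow2[OF x]) auto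
    also have "\<dots> = (4 * Q) ^ n / fact n"
      unfolding times_divide_eq_left power_mult_distrib[symmetric] by (simp add: mult.commute)
    finally show ?thesis by simp
  qed
  have sup_f1: "norm (f1 (Suc n) x) \<le> (4 * Q) ^ Suc n / fact (Suc n)" if x: "x \<in> {-2..2}" for n x
  proof -
    have "\<bar>f1 (Suc n) x\<bar> \<le> Q * (2 * Q) ^ n / fact (Suc n) * \<bar>x\<bar> ^ Suc n"
      using x by (intro bound_f1 bound_f) auto
    also have "\<dots> \<le> 2 * Q * (2 * Q) ^ n / fact (Suc n) * 2 ^ Suc n"
      using Q0 by (intro mult_mono pow2[OF x] divide_right_mono mult_right_mono) auto
    also have "\<dots> = (2 * Q) ^ Suc n * 2 ^ Suc n / fact (Suc n)" by simp
    also have "\<dots> = (4 * Q) ^ Suc n / fact (Suc n)"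
      unfolding power_mult_distrib[symmetric] by (simp only: mult.commute mult.left_commute) simp
    finally show ?thesis by simp
  qed
  have summ: "summable (\<lambda>n. (4 * Q) ^ n / fact n)"
    using summable_exp[of "4 * Q"] by (simp add: divide_inverse mult.commute)
  have uc1: "uniformly_convergent_on {-2..2} (\<lambda>n x. \<Sum>i<n. f1 i x)"
  proof (rule Weierstrass_m_test'[OF _ summ])
    show "norm (f1 n x) \<le> (4 * Q) ^ n / fact n" if "x \<in> {-2..2}" for n x
      using sup_f1[OF that] by (cases n) (auto simp: f1_0)
  qed
  have uc2: "uniformly_convergent_on {-2..2} (\<lambda>n x. \<Sum>i<n. f2 i x)"
  proof (rule Weierstrass_m_test')
    let ?b = "\<lambda>n. case n of 0 \<Rightarrow> 0 | Suc m \<Rightarrow> Q * ((4 * Q) ^ m / fact m)"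
    show "summable ?b"
      using summable_mult[OF summ, of Q] by (subst summable_Suc_iff[symmetric]) simp
    show "norm (f2 n x) \<le> ?b n" if "x \<in> {-2..2}" for n x
      using mult_mono[OF Q[of x] sup_f[OF that]] Q0
      by (cases n) (auto simp: f2_0 f2_Suc abs_mult)
  qed
  have zero: "f (Suc n) 0 = 0" "f1 n 0 = 0" for n
    using A(1)[OF contf1] A(1)[OF contf2] by (auto simp: f_Suc f1_def f2_def split: nat.split)
  have s0: "summable (\<lambda>n. f n 0)"
    by (subst summable_Suc_iff[symmetric]) (simp add: zero)
  have s1: "summable (\<lambda>n. f1 n 0)" by (simp add: zero)
  define y where "y x = (\<Sum>n. f n x)" for x
  define y1 where "y1 x = (\<Sum>n. f1 n x)" for x
  show ?thesis
  proof (rule exI[of _ y], rule exI[of _ y1], intro conjI ballI)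
    show "y 0 = 1"
      unfolding y_def using suminf_split_head[OF s0] by (simp add: zero f_0)
    show "y1 0 = 0"
      by (simp add: y1_def zero)
    fix x :: real assume "x \<in> {-1..1}"
    \<comment> \<open>The series is controlled on the larger interval so that the derivatives at -1
      and 1 are two-sided.\<close>
    then have x: "x \<in> interior {-2..2}" by simp
    have "(y has_real_derivative (\<Sum>n. f1 n x)) (at x)"
      unfolding y_def
      by (rule has_field_derivative_series'[where f = f and f' = f1 and ?x0.0 = 0, OF _ _ uc1 _ s0 x]) (auto intro: DERIV_subset[OF df])
    then show "(y has_real_derivative y1 x) (at x)"
      by (simp add: y1_def)
    have "summable (\<lambda>n. f n x)"
      by (rule has_field_derivative_series'[where f = f and f' = f1 and ?x0.0 = 0, OF _ _ uc1 _ s0 x]) (auto intro: DERIV_subset[OF df])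
    moreover have "summable (\<lambda>n. f2 n x)"
      using x uc2 by (auto simp: summable_iff_convergent intro: uniformly_convergent_imp_convergent)
    ultimately have "(\<Sum>n. f2 n x) = q x * y x"
      using suminf_split_head[of "\<lambda>n. f2 n x"] by (simp add: f2_0 f2_Suc y_def suminf_mult)
    moreover have "(y1 has_real_derivative (\<Sum>n. f2 n x)) (at x)"
      unfolding y1_def
      by (rule has_field_derivative_series'[where f = f1 and f' = f2 and ?x0.0 = 0, OF _ _ uc2 _ s1 x]) (auto intro: DERIV_subset[OF df1])
    ultimately show "(y1 has_real_derivative q x * y x) (at x)" by simp
  qed
qed

text \<open>Uniqueness applied to the reversed function x -> y (t - x). It serves to exclude double
  zeros of a solution that equals 1 at the origin.\<close>

lemma second_order_zero_backwards:
  fixes y y1 y2 :: "real \<Rightarrow> real"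
  assumes t: "0 \<le> t" and L: "0 \<le> L"
    and y: "\<And>x. x \<in> {0..t} \<Longrightarrow> (y has_real_derivative y1 x) (at x)"
    and y1: "\<And>x. x \<in> {0..t} \<Longrightarrow> (y1 has_real_derivative y2 x) (at x)"
    and y2: "\<And>x. x \<in> {0..t} \<Longrightarrow> \<bar>y2 x\<bar> \<le> L * \<bar>y x\<bar>"
    and "y t = 0" "y1 t = 0"
  shows "y 0 = 0"
proof -
  have refl: "((\<lambda>x. g (t - x)) has_real_derivative - D) (at x)"
    if "(g has_real_derivative D) (at (t - x))" for g :: "real \<Rightarrow> real" and D x
  proof -
    have "((\<lambda>x. t - x) has_real_derivative -1) (at x)" by (auto intro!: derivative_eq_intros)
    from DERIV_chain2[OF that this] show ?thesis by simp
  qed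
  have "y (t - t) = 0"
  proof (rule second_order_unique_right[of t L "\<lambda>x. y (t - x)" "\<lambda>x. - y1 (t - x)" "\<lambda>x. y2 (t - x)"])
    fix x assume x: "x \<in> {0..t}"
    then have tx: "t - x \<in> {0..t}" by auto
    show "((\<lambda>x. y (t - x)) has_real_derivative - y1 (t - x)) (at x)"
      by (rule refl[OF y[OF tx]])
    show "((\<lambda>x. - y1 (t - x)) has_real_derivative y2 (t - x)) (at x)"
      using DERIV_minus[OF refl[OF y1[OF tx]]] by simp
    show "\<bar>y2 (t - x)\<bar> \<le> L * \<bar>y (t - x)\<bar>" by (rule y2[OF tx])
  qed (use assms in auto)
  then show ?thesis by simp
qed

text \<open>Shooting from the origin: the least parameter for which the even solution stops being
  positive on \<open>[0,1]\<close> is an eigenvalue.\<close>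

lemma exists_even_dirichlet_solution:
  fixes V \<phi> \<phi>1 \<phi>2 :: "real \<Rightarrow> real"
  assumes V: "continuous_on UNIV V" and B: "\<And>x. 0 \<le> V x" "\<And>x. V x \<le> B"
    and even: "\<And>x. V (- x) = V x"
    and \<phi>: "continuous_on {0..1} \<phi>" "\<phi> 1 = 0" "\<And>x. x \<in> {0..<1} \<Longrightarrow> 0 < \<phi> x"
    and \<phi>': "\<And>x. x \<in> {0..<1} \<Longrightarrow> (\<phi> has_real_derivative \<phi>1 x) (at x)" and \<phi>1_0: "\<phi>1 0 = 0"
    and \<phi>'': "\<And>x. x \<in> {0..<1} \<Longrightarrow> (\<phi>1 has_real_derivative \<phi>2 x) (at x)"
    and sub: "\<And>x. x \<in> {0..<1} \<Longrightarrow> 0 \<le> \<phi>2 x + (V x + \<beta>) * \<phi> x"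
  shows "\<exists>b\<le>\<beta>. \<exists>y y1. y 0 = 1 \<and> y 1 = 0 \<and> y (-1) = 0 \<and>
    (\<forall>x\<in>{-1..1}. (y has_real_derivative y1 x) (at x) \<and>
                 (y1 has_real_derivative - (V x + b) * y x) (at x))"
proof -
  have "\<exists>y y1. y 0 = 1 \<and> y1 0 = 0 \<and>
    (\<forall>x\<in>{-1..1}. (y has_real_derivative y1 x) (at x) \<and>
                 (y1 has_real_derivative - (V x + b) * y x) (at x))" for b
  proof (rule linear_ode_exists[where q = "\<lambda>x. - (V x + b)" and Q = "B + \<bar>b\<bar>"])
    show "continuous_on UNIV (\<lambda>x. - (V x + b))"
      by (intro continuous_intros V)
    show "\<bar>- (V x + b)\<bar> \<le> B + \<bar>b\<bar>" for x
      using B(1)[of x] B(2)[of x] by linarith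
  qed
  then obtain Y Y1 where Y0: "Y b 0 = 1" and Y10: "Y1 b 0 = 0"
    and Y: "x \<in> {-1..1} \<Longrightarrow> (Y b has_real_derivative Y1 b x) (at x)"
    and Y1: "x \<in> {-1..1} \<Longrightarrow> (Y1 b has_real_derivative - (V x + b) * Y b x) (at x)" for b x :: real
    by metis
  have contY: "continuous_on {0..1} (Y b)" for b
    by (intro continuous_at_imp_continuous_on ballI DERIV_isCont[OF Y]) auto
  \<comment> \<open>For such b the coefficient V + b is nonpositive, so Y Y' has derivative Y'^2 -
    (V + b) Y^2 >= 0. Hence Y^2 is nondecreasing from the value 1 and cannot vanish.\<close>
  have pos_low: "0 < Y b t" if b: "b \<le> - B" and t: "t \<in> {0..1}" for b t
  proof (rule ccontr)
    assume "\<not> 0 < Y b t"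
    then obtain s where s: "0 \<le> s" "s \<le> t" "Y b s = 0"
      using IVT2'[of "Y b" t 0 0] Y0 t continuous_on_subset[OF contY[of b]] by auto
    have nonneg: "0 \<le> Y b x * Y1 b x" if x: "x \<in> {0..s}" for x
    proof -
      have "Y b 0 * Y1 b 0 \<le> Y b x * Y1 b x"
      proof (rule DERIV_nonneg_imp_nondecreasing[where f = "\<lambda>x. Y b x * Y1 b x"])
        show "0 \<le> x" using x by simp
        fix z assume "0 \<le> z" "z \<le> x"
        then have z: "z \<in> {-1..1}" using x s t by auto
        have "((\<lambda>x. Y b x * Y1 b x) has_real_derivative (Y1 b z)\<^sup>2 - (V z + b) * (Y b z)\<^sup>2) (at z)"
          using DERIV_mult[OF Y[OF z] Y1[OF z], of b b] by (simp add: power2_eq_square algebra_simps)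
        moreover have "(V z + b) * (Y b z)\<^sup>2 \<le> 0"
          using B(2)[of z] b by (intro mult_nonpos_nonneg) auto
        ultimately show "\<exists>D. ((\<lambda>x. Y b x * Y1 b x) has_real_derivative D) (at z) \<and> 0 \<le> D"
          by (smt (verit) zero_le_power2)
      qed
      then show ?thesis by (simp add: Y10)
    qed
    have "(Y b 0)\<^sup>2 \<le> (Y b s)\<^sup>2"
    proof (rule DERIV_nonneg_imp_nondecreasing[where f = "\<lambda>x. (Y b x)\<^sup>2"])
      show "0 \<le> s" by fact
      fix z assume "0 \<le> z" "z \<le> s"
      then show "\<exists>D. ((\<lambda>x. (Y b x)\<^sup>2) has_real_derivative D) (at z) \<and> 0 \<le> D"
        using s t nonneg[of z] by (intro exI[of _ "2 * (Y b z * Y1 b z)"]) (auto intro!: derivative_eq_intros Y)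
    qed
    then show False using s Y0 by simp
  qed
  \<comment> \<open>A bound for |V + b| uniform over b in [-B - 1, \<beta>]; the extra 1 leaves room
    for parameters just below the infimum chosen later.\<close>
  define Q where "Q = 2 * B + 1 + \<bar>\<beta>\<bar>"
  have B0: "0 \<le> B" using B[of 0] by linarith
  define K where "K = exp (2 + Q)"
  have K: "0 < K" by (simp add: K_def)
  have Qb: "\<bar>- (V x + b)\<bar> \<le> Q" if "b \<in> {- B - 1..\<beta>}" for b x
    using that B(1)[of x] B(2)[of x] B0 by (auto simp: Q_def)
  have Y2b: "\<bar>- (V x + b) * Y b x\<bar> \<le> Q * \<bar>Y b x\<bar>" if "b \<in> {- B - 1..\<beta>}" for b x
    unfolding abs_mult by (rule mult_right_mono[OF Qb[OF that]]) simp
  have expK: "exp ((2 + Q) * t) \<le> K" if "t \<in> {0..1}" for t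
    using that B0 by (auto simp: K_def Q_def intro!: mult_left_le)
  have Ybound: "(Y b t)\<^sup>2 \<le> K" if b: "b \<in> {- B - 1..\<beta>}" and t: "t \<in> {0..1}" for b t
  proof -
    have "(Y b t)\<^sup>2 + (Y1 b t)\<^sup>2 \<le> ((Y b 0)\<^sup>2 + (Y1 b 0)\<^sup>2 + 0\<^sup>2 * t) * exp ((2 + Q) * t)"
    proof (rule second_order_gronwall[where L = Q])
      fix x assume "x \<in> {0..t}"
      then have x: "x \<in> {-1..1}" using t by auto
      show "(Y b has_real_derivative Y1 b x) (at x)" by (rule Y[OF x])
      show "(Y1 b has_real_derivative - (V x + b) * Y b x) (at x)" by (rule Y1[OF x])
      show "\<bar>- (V x + b) * Y b x\<bar> \<le> Q * \<bar>Y b x\<bar> + 0"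
        using Y2b[OF b, of x] by (simp only: add_0_right)
    qed (use t B0 in \<open>auto simp: Q_def\<close>)
    also have "\<dots> \<le> K" using expK[OF t] by (simp add: Y0 Y10)
    finally show ?thesis by (smt (verit) zero_le_power2)
  qed
  \<comment> \<open>The difference solves the equation for b with the source (c - b) Y c, and |Y c|
    <= sqrt K. The Gronwall estimate then gives continuity in the parameter, uniformly in t.\<close>
  have lip: "\<bar>Y b t - Y c t\<bar> \<le> \<bar>b - c\<bar> * K"
    if b: "b \<in> {- B - 1..\<beta>}" and c: "c \<in> {- B - 1..\<beta>}" and t: "t \<in> {0..1}" for b c t
  proof -
    define e where "e = \<bar>b - c\<bar> * sqrt K"
    have "(Y b t - Y c t)\<^sup>2 + (Y1 b t - Y1 c t)\<^sup>2 \<le>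
      ((Y b 0 - Y c 0)\<^sup>2 + (Y1 b 0 - Y1 c 0)\<^sup>2 + e\<^sup>2 * t) * exp ((2 + Q) * t)"
    proof (rule second_order_gronwall[where L = Q])
      fix x assume "x \<in> {0..t}"
      then have x: "x \<in> {-1..1}" "x \<in> {0..1}" using t by auto
      show "((\<lambda>x. Y b x - Y c x) has_real_derivative Y1 b x - Y1 c x) (at x)"
        by (intro DERIV_diff Y x)
      show "((\<lambda>x. Y1 b x - Y1 c x) has_real_derivative - (V x + b) * Y b x - - (V x + c) * Y c x) (at x)"
        by (intro DERIV_diff Y1 x)
      have "- (V x + b) * Y b x - - (V x + c) * Y c x = - (V x + b) * (Y b x - Y c x) + (c - b) * Y c x"
        by (simp add: algebra_simps)
      also have "\<bar>\<dots>\<bar> \<le> \<bar>- (V x + b)\<bar> * \<bar>Y b x - Y c x\<bar> + \<bar>c - b\<bar> * \<bar>Y c x\<bar>"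
        unfolding abs_mult[symmetric] by (rule abs_triangle_ineq)
      also have "\<dots> \<le> Q * \<bar>Y b x - Y c x\<bar> + \<bar>c - b\<bar> * sqrt K"
        by (intro add_mono mult_right_mono mult_left_mono Qb[OF b] real_le_rsqrt) (auto simp: Ybound[OF c x(2)])
      finally show "\<bar>- (V x + b) * Y b x - - (V x + c) * Y c x\<bar> \<le> Q * \<bar>Y b x - Y c x\<bar> + e"
        by (simp add: e_def abs_minus_commute)
    qed (use t B0 K in \<open>auto simp: Q_def e_def\<close>)
    also have "\<dots> \<le> (e\<^sup>2 * 1) * K"
      unfolding Y0 Y10 using t by (intro mult_mono expK) (auto intro: mult_left_le)
    also have "\<dots> = (\<bar>b - c\<bar> * K)\<^sup>2"
      using K by (simp add: e_def power_mult_distrib power2_eq_square)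
    finally have "(Y b t - Y c t)\<^sup>2 \<le> (\<bar>b - c\<bar> * K)\<^sup>2"
      by (smt (verit) zero_le_power2)
    then show ?thesis using K by (simp add: abs_le_square_iff[symmetric] abs_mult)
  qed
  define N where "N = {b. b \<le> \<beta> \<and> (\<exists>t\<in>{0..1}. Y b t \<le> 0)}"
  \<comment> \<open>Sturm comparison: if Y were positive on [0,1], the Wronskian of \<phi> and Y
    would be nonnegative and \<phi> / Y nondecreasing, against \<phi> 0 > 0 = \<phi> 1.\<close>
  have "\<beta> \<in> N"
  proof (rule ccontr)
    assume "\<beta> \<notin> N"
    then have pos: "0 < Y \<beta> t" if "t \<in> {0..1}" for t using that by (force simp: N_def)
    have w: "0 \<le> \<phi>1 t * Y \<beta> t - \<phi> t * Y1 \<beta> t" if t: "t \<in> {0..<1}" for t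
    proof -
      have "\<phi>1 0 * Y \<beta> 0 - \<phi> 0 * Y1 \<beta> 0 \<le> \<phi>1 t * Y \<beta> t - \<phi> t * Y1 \<beta> t"
      proof (rule DERIV_nonneg_imp_nondecreasing[where f = "\<lambda>x. \<phi>1 x * Y \<beta> x - \<phi> x * Y1 \<beta> x"])
        show "0 \<le> t" using t by simp
        fix z assume "0 \<le> z" "z \<le> t"
        then have z: "z \<in> {0..<1}" "z \<in> {-1..1}" "z \<in> {0..1}" using t by auto
        have "((\<lambda>x. \<phi>1 x * Y \<beta> x - \<phi> x * Y1 \<beta> x) has_real_derivative
            Y \<beta> z * (\<phi>2 z + (V z + \<beta>) * \<phi> z)) (at z)"
          by (auto intro!: derivative_eq_intros \<phi>'[OF z(1)] \<phi>''[OF z(1)] Y[OF z(2)] Y1[OF z(2)]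
              simp: algebra_simps)
        moreover have "0 \<le> Y \<beta> z * (\<phi>2 z + (V z + \<beta>) * \<phi> z)"
          using pos[OF z(3)] sub[OF z(1)] by simp
        ultimately show "\<exists>D. ((\<lambda>x. \<phi>1 x * Y \<beta> x - \<phi> x * Y1 \<beta> x) has_real_derivative D) (at z) \<and> 0 \<le> D"
          by blast
      qed
      then show ?thesis by (simp add: Y10 \<phi>1_0)
    qed
    have "\<phi> 0 / Y \<beta> 0 \<le> \<phi> 1 / Y \<beta> 1"
    proof (rule DERIV_nonneg_imp_increasing_open[where f = "\<lambda>x. \<phi> x / Y \<beta> x"])
      fix z :: real assume "0 < z" "z < 1"
      then have z: "z \<in> {0..<1}" "z \<in> {-1..1}" "z \<in> {0..1}" by auto
      have "((\<lambda>x. \<phi> x / Y \<beta> x) has_real_derivative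
          (\<phi>1 z * Y \<beta> z - \<phi> z * Y1 \<beta> z) / (Y \<beta> z * Y \<beta> z)) (at z)"
        using pos[OF z(3)] by (intro DERIV_divide \<phi>'[OF z(1)] Y[OF z(2)]) auto
      then show "\<exists>D. ((\<lambda>x. \<phi> x / Y \<beta> x) has_real_derivative D) (at z) \<and> 0 \<le> D"
        using w[OF z(1)] by (auto intro!: exI divide_nonneg_nonneg)
    next
      show "continuous_on {0..1} (\<lambda>x. \<phi> x / Y \<beta> x)"
        using pos by (intro continuous_on_divide \<phi> contY) force
    qed simp
    then show False using \<phi>(2) \<phi>(3)[of 0] Y0 by simp
  qed
  have N_low: "- B < b" if "b \<in> N" for b
    using that pos_low[of b] by (force simp: N_def)
  have bdd: "bdd_below N" using N_low by (meson bdd_below.I less_imp_le)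
  define b where "b = Inf N"
  have b: "b \<in> {- B..\<beta>}"
    using cInf_lower[OF \<open>\<beta> \<in> N\<close> bdd] cInf_greatest[of N "- B"] \<open>\<beta> \<in> N\<close> N_low
    by (force simp: b_def)
  then have b': "b \<in> {- B - 1..\<beta>}" by auto
  \<comment> \<open>A negative value would persist for parameters slightly below the infimum, all of
    which lie outside N. The cap 1 in the choice of c keeps c within the range where
    \<open>lip\<close> applies.\<close>
  have nonneg: "0 \<le> Y b t" if t: "t \<in> {0..1}" for t
  proof (rule ccontr)
    assume neg: "\<not> 0 \<le> Y b t"
    define \<eta> where "\<eta> = - Y b t / (2 * K)"
    have "0 < \<eta>" using neg K by (simp add: \<eta>_def divide_less_0_iff)
    define c where "c = b - min 1 \<eta>"
    have c: "c < b" "c \<in> {- B - 1..\<beta>}" "\<bar>b - c\<bar> \<le> - Y b t / (2 * K)"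
      using \<open>0 < \<eta>\<close> b unfolding c_def \<eta>_def[symmetric] by (auto simp: min_def)
    have "c \<notin> N" using c(1) cInf_lower[OF _ bdd, of c] by (auto simp: b_def)
    then have "0 < Y c t" using c t by (force simp: N_def)
    moreover have "\<bar>Y b t - Y c t\<bar> \<le> - Y b t / (2 * K) * K"
      using lip[OF b' c(2) t] mult_right_mono[OF c(3), of K] K by linarith
    ultimately show False using K neg by (simp add: field_simps)
  qed
  \<comment> \<open>Since Y b is nonnegative, a zero inside would be a local minimum, hence a double
    zero.\<close>
  have pos: "0 < Y b t" if t: "t \<in> {0..<1}" for t
  proof (rule ccontr)
    assume "\<not> 0 < Y b t"
    then have Yt: "Y b t = 0" using nonneg[of t] t by auto
    then have t0: "0 < t" using Y0[of b] t by (cases "t = 0") auto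
    have "Y1 b t = 0"
    proof (rule DERIV_local_min[OF Y])
      show "t \<in> {-1..1}" using t by auto
      show "0 < min t (1 - t)" using t t0 by auto
      show "\<forall>y. \<bar>t - y\<bar> < min t (1 - t) \<longrightarrow> Y b t \<le> Y b y"
        unfolding Yt by (intro allI impI nonneg) auto
    qed
    have "Y b 0 = 0"
    proof (rule second_order_zero_backwards[where L = Q])
      fix x assume "x \<in> {0..t}"
      then have x: "x \<in> {-1..1}" using t by auto
      show "(Y b has_real_derivative Y1 b x) (at x)" by (rule Y[OF x])
      show "(Y1 b has_real_derivative - (V x + b) * Y b x) (at x)" by (rule Y1[OF x])
      show "\<bar>- (V x + b) * Y b x\<bar> \<le> Q * \<bar>Y b x\<bar>" by (rule Y2b[OF b'])
    qed (use t t0 B0 Yt \<open>Y1 b t = 0\<close> in \<open>auto simp: Q_def\<close>)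
    then show False by (simp add: Y0)
  qed
  \<comment> \<open>Otherwise Y b has a positive minimum on [0,1], and positivity persists for
    parameters slightly above b, so that b could not be the infimum of N.\<close>
  have Y_1: "Y b 1 = 0"
  proof (rule ccontr)
    assume "Y b 1 \<noteq> 0"
    then have pos: "0 < Y b t" if "t \<in> {0..1}" for t
      using that pos[of t] nonneg[of 1] by (cases "t = 1") auto
    obtain m where m: "m \<in> {0..1}" "\<And>t. t \<in> {0..1} \<Longrightarrow> Y b m \<le> Y b t"
      using continuous_attains_inf[OF _ _ contY[of b]] by (metis atLeastatMost_empty_iff compact_Icc zero_le_one)
    have "b < b + Y b m / (2 * K)" using pos[OF m(1)] K by simp
    then obtain c where c: "c \<in> N" "c < b + Y b m / (2 * K)"
      using cInf_less_iff[OF _ bdd, of "b + Y b m / (2 * K)"] \<open>\<beta> \<in> N\<close> by (auto simp: b_def)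
    have bc: "b \<le> c" unfolding b_def by (rule cInf_lower[OF c(1) bdd])
    have c': "c \<in> {- B - 1..\<beta>}" using c N_low[of c] by (auto simp: N_def)
    obtain t where t: "t \<in> {0..1}" "Y c t \<le> 0" using c by (auto simp: N_def)
    have "\<bar>b - c\<bar> * K \<le> Y b m / (2 * K) * K" using bc c K by (intro mult_right_mono) auto
    then have "\<bar>Y b t - Y c t\<bar> \<le> Y b m / 2" using lip[OF b' c' t(1)] K by simp
    then show False using m(2)[OF t(1)] pos[OF m(1)] t(2) by linarith
  qed
  have "Y b (- 1) = Y b 1"
  proof -
    have "Y b 1 - Y b (- 1) = 0"
    proof (rule second_order_unique_right[where L = Q and d = "\<lambda>x. Y b x - Y b (- x)"])
      fix x :: real assume "x \<in> {0..1}"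
      then have x: "x \<in> {-1..1}" "- x \<in> {-1..1}" by auto
      show "((\<lambda>x. Y b x - Y b (- x)) has_real_derivative Y1 b x - - Y1 b (- x)) (at x)"
        by (intro DERIV_diff Y has_real_derivative_reflect x)
      have "((\<lambda>x. Y1 b x + Y1 b (- x)) has_real_derivative
          - (V x + b) * Y b x + - (- (V (- x) + b) * Y b (- x))) (at x)"
        by (intro DERIV_add Y1 has_real_derivative_reflect x)
      then show "((\<lambda>x. Y1 b x - - Y1 b (- x)) has_real_derivative
          - (V x + b) * (Y b x - Y b (- x))) (at x)"
        by (simp add: even algebra_simps)
      show "\<bar>- (V x + b) * (Y b x - Y b (- x))\<bar> \<le> Q * \<bar>Y b x - Y b (- x)\<bar>"
        unfolding abs_mult by (rule mult_right_mono[OF Qb[OF b']]) simp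
    qed (use B0 in \<open>auto simp: Q_def Y10\<close>)
    then show ?thesis by simp
  qed
  then show ?thesis
    using b Y_1 Y Y1 Y0 by (metis atLeastAtMost_iff)
qed

section \<open>The Lane--Emden solution\<close>

text \<open>The given solution may have no two-sided derivatives at -1 and 1, because its outside
  values are arbitrary. Integrating the equation twice with a clamped right-hand side gives a
  function that has them and agrees with it on [-1,1].\<close>

lemma positive_solution_C2_extension:
  assumes "positive_solution p v" "1 < p"
  shows "\<exists>u u1. (\<forall>x. (u has_real_derivative u1 x) (at x)) \<and>
    (\<forall>x\<in>{-1..1}. (u1 has_real_derivative - (u x powr p)) (at x)) \<and> (\<forall>x\<in>{-1..1}. u x = v x)"
proof -
  have contv: "continuous_on {-1..1} v" and v0: "v (-1) = 0" "v 1 = 0"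
    and diff: "\<And>t. t \<in> {-1<..<1} \<Longrightarrow> v differentiable (at t)"
      "\<And>t. t \<in> {-1<..<1} \<Longrightarrow> deriv v differentiable (at t)"
    and pos: "\<And>t. t \<in> {-1<..<1} \<Longrightarrow> 0 < v t"
    and ode: "\<And>t. t \<in> {-1<..<1} \<Longrightarrow> deriv (deriv v) t = - (v t powr p)"
    using assms(1) by (force simp: positive_solution_def dirichlet_function_def twice_differentiable_on_def)+
  have dv: "(v has_real_derivative deriv v t) (at t)" if "t \<in> {-1<..<1}" for t
    using diff(1)[OF that] by (simp add: DERIV_deriv_iff_real_differentiable)
  have ddv: "(deriv v has_real_derivative - (v t powr p)) (at t)" if "t \<in> {-1<..<1}" for t
    using diff(2)[OF that] by (simp add: DERIV_deriv_iff_real_differentiable flip: ode[OF that])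
  have nonneg: "0 \<le> v t" if "t \<in> {-1..1}" for t
    using pos[of t] v0 that by (cases "t = -1 \<or> t = 1") auto
  define h where "h x = - (v (max (-1) (min 1 x)) powr p)" for x
  have conth: "continuous_on UNIV h"
    unfolding h_def
    by (intro continuous_on_minus continuous_on_powr' continuous_on_compose2[OF contv] continuous_intros)
      (use assms nonneg in auto)
  obtain u1 where u1: "u1 0 = deriv v 0" "\<And>x. (u1 has_real_derivative h x) (at x)"
    using antiderivative_on_reals[OF conth] by blast
  have contu1: "continuous_on UNIV u1"
    using u1(2) by (intro continuous_at_imp_continuous_on) (auto intro: DERIV_isCont)
  obtain u where u: "u 0 = v 0" "\<And>x. (u has_real_derivative u1 x) (at x)"
    using antiderivative_on_reals[OF contu1] by blast
  have contu: "continuous_on UNIV u"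
    using u(2) by (intro continuous_at_imp_continuous_on) (auto intro: DERIV_isCont)
  have eq1: "deriv v x - u1 x = deriv v 0 - u1 0" if x: "x \<in> {-1<..<1}" for x
  proof (rule DERIV_isconst3[of "-1" 1 _ _ "\<lambda>x. deriv v x - u1 x"])
    fix y :: real assume y: "y \<in> {-1<..<1}"
    then have "h y = - (v y powr p)" by (auto simp: h_def)
    then show "((\<lambda>x. deriv v x - u1 x) has_real_derivative 0) (at y)"
      using DERIV_diff[OF ddv[OF y] u1(2)[of y]] by simp
  qed (use x in auto)
  have eq: "v x - u x = v 0 - u 0" if x: "x \<in> {-1<..<1}" for x
  proof (rule DERIV_isconst3[of "-1" 1 _ _ "\<lambda>x. v x - u x"])
    fix y :: real assume y: "y \<in> {-1<..<1}"
    then show "((\<lambda>x. v x - u x) has_real_derivative 0) (at y)"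
      using DERIV_diff[OF dv[OF y] u(2)[of y]] eq1[OF y] u1(1) by simp
  qed (use x in auto)
  have uv: "u x = v x" if x: "x \<in> {-1..1}" for x
  proof -
    have "v x - u x = 0"
    \<comment> \<open>Agreement inside passes to the end points by continuity.\<close>
    proof (rule continuous_constant_on_closure[of "{-1<..<1}" "\<lambda>x. v x - u x"])
      show "continuous_on (closure {-1<..<1}) (\<lambda>x. v x - u x)"
        using contv continuous_on_subset[OF contu] by (auto intro!: continuous_intros)
    qed (use x eq u in auto)
    then show ?thesis by simp
  qed
  have "(u1 has_real_derivative - (u x powr p)) (at x)" if "x \<in> {-1..1}" for x
    using u1(2)[of x] uv[OF that] that by (simp add: h_def)
  then show ?thesis using u(2) uv by blast
qed

text \<open>By the mean value theorem; r > 1 keeps the derivative bounded down to the base 0, so the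
  uniqueness lemma applies up to the boundary zeros of the solution.\<close>

lemma powr_lipschitz:
  fixes x y M r :: real
  assumes x: "x \<in> {0..M}" and y: "y \<in> {0..M}" and r: "1 < r"
  shows "\<bar>x powr r - y powr r\<bar> \<le> r * M powr (r - 1) * \<bar>x - y\<bar>"
  using x y
proof (induction x y rule: linorder_wlog)
  case (le x y)
  show ?case
  proof (cases "x = y")
    case False
    then have "x < y" using le by simp
    moreover have "continuous_on {x..y} (\<lambda>x. x powr r)"
      using le r by (intro continuous_on_powr' continuous_intros) auto
    moreover have der: "((\<lambda>x. x powr r) has_real_derivative r * z powr (r - 1)) (at z)" if "x < z" for z
      using that le by (auto intro!: derivative_eq_intros)
    ultimately obtain l z where z: "x < z" "z < y" "((\<lambda>x. x powr r) has_real_derivative l) (at z)"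
      "y powr r - x powr r = (y - x) * l"
      using MVT[of x y "\<lambda>x. x powr r"] by (force simp: real_differentiable_def)
    have "l = r * z powr (r - 1)" using DERIV_unique[OF z(3) der[OF z(1)]] .
    also have "\<dots> \<le> r * M powr (r - 1)"
      using z le r by (intro mult_left_mono powr_mono2) auto
    finally have "l \<le> r * M powr (r - 1)" .
    moreover have "0 \<le> l" using \<open>l = _\<close> r by simp
    ultimately show ?thesis
      using z \<open>x < y\<close> mult_left_mono[of l "r * M powr (r - 1)" "y - x"]
      by (simp add: abs_minus_commute[of "x powr r"] abs_minus_commute[of x] mult.commute)
  qed simp
next
  case (sym x y)
  then show ?case by (simp add: abs_minus_commute)
qed

lemma tanh_artanh_real:
  fixes x :: real
  assumes "\<bar>x\<bar> < 1"
  shows "tanh (artanh x) = x"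
proof -
  have "exp (- 2 * artanh x) = inverse ((1 + x) / (1 - x))"
    unfolding artanh_def using assms by (simp add: exp_minus)
  also have "\<dots> = (1 - x) / (1 + x)" by (simp add: inverse_divide)
  finally have "tanh (artanh x) = (1 - (1 - x) / (1 + x)) / (1 + (1 - x) / (1 + x))"
    by (simp only: tanh_real_altdef)
  also have "\<dots> = x" using assms by (simp add: field_simps)
  finally show ?thesis .
qed

text \<open>The analysis runs on the extension \<open>u\<close>; \<open>v\<close> is the given
  solution and enters where results are transferred back to it.\<close>

locale lane_emden =
  fixes p :: real and u u1 v :: "real \<Rightarrow> real"
  assumes p: "1 < p"
    and u: "\<And>x. (u has_real_derivative u1 x) (at x)"
    and u1: "\<And>x. x \<in> {-1..1} \<Longrightarrow> (u1 has_real_derivative - (u x powr p)) (at x)"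
    and u_pos: "\<And>x. x \<in> {-1<..<1} \<Longrightarrow> 0 < u x"
    and u_left: "u (-1) = 0" and u_right: "u 1 = 0"
    and v: "\<And>x. x \<in> {-1..1} \<Longrightarrow> u x = v x"
begin

lemma u_nonneg: "x \<in> {-1..1} \<Longrightarrow> 0 \<le> u x"
  using u_pos[of x] u_left u_right by (cases "x = -1 \<or> x = 1") auto

lemma continuous_on_u: "continuous_on S u"
  using u by (intro continuous_at_imp_continuous_on) (auto intro: DERIV_isCont)

text \<open>At a maximum point t the derivative vanishes, so uniqueness makes u symmetric about t up
  to the distance r = 1 - |t| of the nearer end point. It remains to see that t = 0.\<close>

lemma u_even_and_le: "x \<in> {-1..1} \<Longrightarrow> u (- x) = u x" "x \<in> {-1..1} \<Longrightarrow> u x \<le> u 0"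
proof -
  obtain t where t: "t \<in> {-1..1}" and max: "\<And>x. x \<in> {-1..1} \<Longrightarrow> u x \<le> u t"
    using continuous_attains_sup[of "{-1..1}" u] continuous_on_u by auto
  have "0 < u t" using max[of 0] u_pos[of 0] by simp
  then have t': "t \<in> {-1<..<1}" using t u_left u_right by (cases "t = -1 \<or> t = 1") auto
  define r where "r = 1 - \<bar>t\<bar>"
  have r: "0 < r" using t' by (auto simp: r_def)
  have "u1 t = 0"
    by (rule DERIV_local_max[OF u r]) (auto intro!: max simp: r_def)
  have refl: "(\<lambda>x. u (x + t) - u (- x + t)) s = 0" if s: "\<bar>s\<bar> \<le> r" for s
  proof (rule second_order_unique[where d = "\<lambda>x. u (x + t) - u (- x + t)" and L = "p * u t powr (p - 1)" and R = r])
    fix x assume "\<bar>x\<bar> \<le> r"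
    then have x: "x + t \<in> {-1..1}" "- x + t \<in> {-1..1}" by (auto simp: r_def)
    have refl: "((\<lambda>x. g (- x + t)) has_real_derivative - D) (at x)"
      if "(g has_real_derivative D) (at (- x + t))" for g :: "real \<Rightarrow> real" and D
    proof -
      have "((\<lambda>x. - x + t) has_real_derivative -1) (at x)" by (auto intro!: derivative_eq_intros)
      from DERIV_chain2[OF that this] show ?thesis by simp
    qed
    show "((\<lambda>x. u (x + t) - u (- x + t)) has_real_derivative u1 (x + t) - - u1 (- x + t)) (at x)"
      by (intro DERIV_diff refl u) (simp add: u flip: DERIV_shift)
    have "((\<lambda>x. u1 (x + t) + u1 (- x + t)) has_real_derivative
        - (u (x + t) powr p) + - (- (u (- x + t) powr p))) (at x)"
      by (intro DERIV_add refl u1 x DERIV_shift[THEN iffD1])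
    then show "((\<lambda>x. u1 (x + t) - - u1 (- x + t)) has_real_derivative
        - (u (x + t) powr p - u (- x + t) powr p)) (at x)" by simp
    show "\<bar>- (u (x + t) powr p - u (- x + t) powr p)\<bar>
        \<le> p * u t powr (p - 1) * \<bar>u (x + t) - u (- x + t)\<bar>"
      unfolding abs_minus_cancel by (rule powr_lipschitz) (use x p max u_nonneg in auto)
  qed (use p s \<open>u1 t = 0\<close> in auto)
  have "t = 0"
  proof (rule ccontr)
    assume "t \<noteq> 0"
    \<comment> \<open>One of the mirror points is an end point, where u vanishes; for t different
      from 0 the other is interior, where u is positive.\<close>
    then have "u (- r + t) \<noteq> 0 \<or> u (r + t) \<noteq> 0" "u (- r + t) = 0 \<or> u (r + t) = 0"
      using u_pos[of "- r + t"] u_pos[of "r + t"] u_left u_right t' by (auto simp: r_def abs_if split: if_splits)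
    then show False using refl[of r] r by auto
  qed
  then show "x \<in> {-1..1} \<Longrightarrow> u (- x) = u x" "x \<in> {-1..1} \<Longrightarrow> u x \<le> u 0"
    using refl[of x] max by (auto simp: r_def)
qed

lemma u1_0: "u1 0 = 0"
  by (rule DERIV_local_max[OF u, of 1]) (auto intro!: u_even_and_le)

lemma u1_odd: "u1 (- x) = - u1 x" if x: "x \<in> {0..1}"
proof -
  have der: "((\<lambda>x. u1 x + u1 (- x)) has_real_derivative 0) (at y)" if "y \<in> {0..x}" for y
  proof -
    have y: "y \<in> {-1..1}" "- y \<in> {-1..1}" using that x by auto
    have "((\<lambda>x. u1 x + u1 (- x)) has_real_derivative - (u y powr p) + - (- (u (- y) powr p))) (at y)"
      by (intro DERIV_add has_real_derivative_reflect u1 y)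
    then show ?thesis using u_even_and_le(1)[OF y(1)] by simp
  qed
  have c: "((\<lambda>x. 0) has_real_derivative 0) (at y)" for y :: real by simp
  have x0: "0 \<le> x" using x by simp
  show ?thesis
    using derivative_mono_imp_le[OF x0 der c] derivative_mono_imp_le[OF x0 c der] u1_0 by simp
qed

definition k :: real where "k = (p + 1) / 2"
definition M :: real where "M = u 0"
text \<open>By \<open>energy\<close> at x = 1 and the sign of \<open>u1\<close>, this equals
  \<open>- u1 1\<close>.\<close>

definition a :: real where "a = sqrt (M powr (p + 1) / k)"
text \<open>The value at the origin, and the least value on [0,1), of the derivative k a / u of
  artanh w.\<close>

definition c :: real where "c = k * a / M"

lemma k_gt1: "1 < k" and two_k: "2 * k - 1 = p"
  using p by (simp_all add: k_def field_simps)

lemma M_pos: "0 < M"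
  using u_pos[of 0] by (simp add: M_def)

lemma a_pos: "0 < a"
  using M_pos k_gt1 by (simp add: a_def)

lemma c_pos: "0 < c"
  using M_pos a_pos k_gt1 by (simp add: c_def)

lemma k_a_sq: "k * a\<^sup>2 = M powr (p + 1)"
  using M_pos k_gt1 by (simp add: a_def)

lemma M_powr: "M powr (p - 1) = c\<^sup>2 / k"
proof -
  have "c\<^sup>2 / k = k * a\<^sup>2 / M\<^sup>2"
    using M_pos k_gt1 by (simp add: c_def power2_eq_square)
  also have "\<dots> = M powr (p + 1 - 2)"
    unfolding k_a_sq powr_diff using M_pos by (simp add: powr_numeral)
  finally show ?thesis by simp
qed

lemma a_eq: "a = M * (c / k)"
  using M_pos k_gt1 by (simp add: c_def)

lemma energy:
  assumes x: "x \<in> {0..1}"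
  shows "(u1 x)\<^sup>2 = a\<^sup>2 - u x powr (p + 1) / k"
proof (cases "x = 0")
  case True
  then show ?thesis using k_a_sq k_gt1 by (simp add: u1_0 flip: M_def) (simp add: field_simps)
next
  case False
  have "(u1 x)\<^sup>2 + u x powr (p + 1) / k = (u1 0)\<^sup>2 + u 0 powr (p + 1) / k"
  \<comment> \<open>This is twice the mechanical energy. It is differentiated only where u > 0; the
    end point x = 1 is reached by continuity.\<close>
  proof (rule DERIV_isconst_end[where f = "\<lambda>x. (u1 x)\<^sup>2 + u x powr (p + 1) / k"])
    show "0 < x" using x False by simp
    have "continuous_on {0..x} u1"
      using x by (intro continuous_at_imp_continuous_on ballI DERIV_isCont[OF u1]) auto
    then show "continuous_on {0..x} (\<lambda>x. (u1 x)\<^sup>2 + u x powr (p + 1) / k)"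
      using x k_gt1 p u_nonneg
      by (intro continuous_intros continuous_on_powr' continuous_on_u) auto
    fix y assume "0 < y" "y < x"
    then have y: "y \<in> {-1..1}" "y \<in> {-1<..<1}" using x by auto
    have "((\<lambda>x. (u1 x)\<^sup>2 + u x powr (p + 1) / k) has_real_derivative
        2 * u1 y * - (u y powr p) + (p + 1) * u y powr p * u1 y / k) (at y)"
      using DERIV_add[OF DERIV_power[OF u1[OF y(1)], of 2]
          DERIV_cdivide[OF DERIV_fun_powr[OF u u_pos[OF y(2)], of "p + 1"], of k]]
      by (simp add: mult_ac)
    then show "((\<lambda>x. (u1 x)\<^sup>2 + u x powr (p + 1) / k) has_real_derivative 0) (at y)"
      using p by (simp add: k_def field_simps)
  qed
  also have "\<dots> = a\<^sup>2" using k_a_sq k_gt1 by (simp add: u1_0 field_simps flip: M_def)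
  finally show ?thesis by simp
qed

lemma u1_nonpos: "u1 x \<le> 0" if "x \<in> {0..1}"
proof -
  have "u1 x \<le> u1 0"
    by (rule DERIV_nonpos_imp_nonincreasing) (use that in \<open>auto intro!: exI u1\<close>)
  then show ?thesis by (simp add: u1_0)
qed

definition w :: "real \<Rightarrow> real" where "w x = - u1 x / a"

lemma one_minus_w_sq: "x \<in> {0..1} \<Longrightarrow> 1 - (w x)\<^sup>2 = u x powr (p + 1) / (k * a\<^sup>2)"
  unfolding w_def power_divide power2_minus energy
  using a_pos k_gt1 by (simp add: diff_divide_distrib)

lemma w_nonneg: "x \<in> {0..1} \<Longrightarrow> 0 \<le> w x"
  using u1_nonpos[of x] a_pos by (simp add: w_def divide_nonpos_pos)

lemma w_le1: "w x \<le> 1" if "x \<in> {0..1}"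
proof -
  have "0 \<le> 1 - (w x)\<^sup>2" using one_minus_w_sq[OF that] k_gt1 by simp
  then show ?thesis using power2_le_imp_le[of "w x" 1] by simp
qed

lemma w_less1: "w x < 1" if "x \<in> {0..<1}"
proof -
  have "0 < u x powr (p + 1) / (k * a\<^sup>2)"
    using k_gt1 a_pos u_pos[of x] that by (intro divide_pos_pos mult_pos_pos) auto
  then have "0 < 1 - (w x)\<^sup>2" using one_minus_w_sq[of x] that by simp
  then show ?thesis using power2_less_imp_less[of "w x" 1] by simp
qed

lemma artanh_w:
  assumes x: "x \<in> {0..<1}"
  shows "((\<lambda>x. artanh (w x)) has_real_derivative k * a / u x) (at x)"
proof -
  have x': "x \<in> {-1..1}" "x \<in> {0..1}" "x \<in> {-1<..<1}" using x by auto
  have w1: "\<bar>w x\<bar> < 1" using w_nonneg[OF x'(2)] w_less1[OF x] by simp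
  have "(w has_real_derivative u x powr p / a) (at x)"
    unfolding w_def using DERIV_cdivide[OF DERIV_minus[OF u1[OF x'(1)]], of a] by simp
  then have "((\<lambda>x. artanh (w x)) has_real_derivative 1 / (1 - (w x)\<^sup>2) * (u x powr p / a)) (at x)"
    by (rule DERIV_chain2[where f = artanh and g = w, OF artanh_real_has_field_derivative[OF w1]])
  also have "1 / (1 - (w x)\<^sup>2) * (u x powr p / a) = k * a / u x"
    unfolding one_minus_w_sq[OF x'(2)] powr_add using u_pos[OF x'(3)] a_pos k_gt1
    by (simp add: field_simps power2_eq_square)
  finally show ?thesis .
qed

lemma artanh_w_0: "artanh (w 0) = 0"
  by (simp add: w_def u1_0)

lemma tanh_artanh_w: "x \<in> {0..<1} \<Longrightarrow> tanh (artanh (w x)) = w x"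
  using w_nonneg[of x] w_less1[of x] by (simp add: tanh_artanh_real)

lemma w_lower: "tanh (c * x) \<le> w x" if x: "x \<in> {0..1}"
proof (cases "x = 1")
  case True
  \<comment> \<open>The end point is treated apart because w reaches 1 there and artanh is no longer
    available.\<close>
  have "1 - (w 1)\<^sup>2 = 0" using one_minus_w_sq[of 1] by (simp add: u_right)
  then have "w 1 = 1" using w_nonneg[of 1] power2_eq_1_iff[of "w 1"] by auto
  then show ?thesis using True tanh_real_lt_1[of c] by simp
next
  case False
  then have x': "x \<in> {0..<1}" "0 \<le> x" using x by auto
  have "c * x - c * 0 \<le> artanh (w x) - artanh (w 0)"
  proof (rule derivative_mono_imp_le[OF x'(2)])
    fix y assume "y \<in> {0..x}"
    then have y: "y \<in> {0..<1}" "y \<in> {-1<..<1}" "y \<in> {-1..1}" using x' by auto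
    show "((\<lambda>x. c * x) has_real_derivative c) (at y)" by (auto intro!: derivative_eq_intros)
    show "((\<lambda>x. artanh (w x)) has_real_derivative k * a / u y) (at y)" by (rule artanh_w[OF y(1)])
    show "c \<le> k * a / u y"
      unfolding c_def using u_pos[OF y(2)] u_even_and_le(2)[OF y(3)] a_pos k_gt1
      by (intro divide_left_mono) (auto simp: M_def)
  qed
  then have "tanh (c * x) \<le> tanh (artanh (w x))" by (simp add: artanh_w_0)
  then show ?thesis by (simp add: tanh_artanh_w[OF x'(1)])
qed

lemma u1_ge: "x \<in> {0..1} \<Longrightarrow> - a \<le> u1 x"
  using w_le1[of x] a_pos by (simp add: w_def field_simps)

lemma u_tangent: "u x + a * x \<le> u y + a * y" if "0 \<le> x" "x \<le> y" "y \<le> 1"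
  using derivative_mono_imp_le[of x y "\<lambda>x. - a * x" "\<lambda>_. - a" u u1] that u1_ge u
  by (fastforce intro!: derivative_eq_intros)

lemma M_le_a: "M \<le> a"
  using u_tangent[of 0 1] by (simp add: M_def u_right)

text \<open>On [0,1] the graph lies between the parallel lines M - a x and a (1 - x), obtained from
  \<open>u_tangent\<close> at 0 and at 1.\<close>

lemma u_approx: "\<bar>u x - a * (1 - \<bar>x\<bar>)\<bar> \<le> a - M" if x: "x \<in> {-1..1}"
proof -
  have "\<bar>u y - a * (1 - y)\<bar> \<le> a - M" if "y \<in> {0..1}" for y
    using u_tangent[of 0 y] u_tangent[of y 1] that M_le_a by (auto simp: M_def u_right algebra_simps abs_le_iff)
  from this[of "\<bar>x\<bar>"] show ?thesis
    using x u_even_and_le(1)[OF x] by (cases "0 \<le> x") auto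
qed

lemma c_ge: "k \<le> c"
  using M_le_a M_pos k_gt1 by (simp add: c_def field_simps)

text \<open>Here ln 2 is rounded up to 1, which is harmless since only c / k -> 1 is used in the
  limit.\<close>

lemma c_le: "c \<le> k + 1"
proof -
  \<comment> \<open>The left side is the increment of an antiderivative of a tanh (c x). Since M c /
    a = k, the inequality reads ln (cosh c) <= k.\<close>
  have "a / c * ln (cosh (c * 1)) - a / c * ln (cosh (c * 0)) \<le> - u 1 - - u 0"
  proof (rule derivative_mono_imp_le)
    fix x :: real assume x: "x \<in> {0..1}"
    show "((\<lambda>x. a / c * ln (cosh (c * x))) has_real_derivative a * tanh (c * x)) (at x)"
      using c_pos by (auto intro!: derivative_eq_intros simp: tanh_def cosh_real_pos)
    show "((\<lambda>x. - u x) has_real_derivative - u1 x) (at x)" by (intro DERIV_minus u)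
    show "a * tanh (c * x) \<le> - u1 x" using w_lower[OF x] a_pos by (simp add: w_def field_simps)
  qed simp
  then have "a / c * ln (cosh c) \<le> M" by (simp add: M_def u_right)
  then have "ln (cosh c) \<le> k" using M_pos a_pos c_pos k_gt1 by (simp add: c_def field_simps)
  moreover have "exp c / 2 \<le> cosh c" by (simp add: cosh_def)
  then have "ln (exp c / 2) \<le> ln (cosh c)" by (subst ln_le_cancel_iff) auto
  ultimately show ?thesis using ln_2_less_1 by (simp add: ln_div)
qed

lemma w_upper: "w x \<le> tanh (c * x / (1 - 2 * x))" if x: "0 \<le> x" "x < 1 / 2"
proof -
  define m where "m = M * (1 - 2 * x)"
  have m: "0 < m" using M_pos x by (simp add: m_def)
  have "artanh (w x) - artanh (w 0) \<le> k * a / m * x - k * a / m * 0"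
  proof (rule derivative_mono_imp_le[OF x(1)])
    fix y assume "y \<in> {0..x}"
    then have y: "y \<in> {0..<1}" "y \<in> {-1<..<1}" "0 \<le> y" "y \<le> 1" "y \<le> x" using x by auto
    show "((\<lambda>x. k * a / m * x) has_real_derivative k * a / m) (at y)"
      by (rule DERIV_cmult_Id)
    show "((\<lambda>x. artanh (w x)) has_real_derivative k * a / u y) (at y)" by (rule artanh_w[OF y(1)])
    \<comment> \<open>Source of the constant 2 in 1 - 2 x: c <= k + 1 <= 2 k gives a <= 2 M, hence u
      y >= M - a y >= M (1 - 2 x) for y <= x.\<close>
    have "c / k \<le> 2" using c_le k_gt1 by (simp add: field_simps)
    then have "a \<le> 2 * M" using M_pos mult_left_mono[of "c / k" 2 M] by (simp add: a_eq)
    then have "a * y \<le> 2 * M * x" using y x M_pos a_pos by (intro mult_mono) auto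
    then have "m \<le> u y" using u_tangent[of 0 y] y by (simp add: m_def M_def algebra_simps)
    then show "k * a / u y \<le> k * a / m"
      using m a_pos k_gt1 by (intro divide_left_mono) auto
  qed
  also have "k * a / m * x - k * a / m * 0 = c * x / (1 - 2 * x)"
    by (simp add: c_def m_def)
  finally have "tanh (artanh (w x)) \<le> tanh (c * x / (1 - 2 * x))" by (simp add: artanh_w_0)
  then show ?thesis using tanh_artanh_w[of x] x by simp
qed

end

section \<open>Bounds for the first eigenvalue\<close>

lemma real_differentiableI: "(f has_real_derivative D) (at x within S) \<Longrightarrow> f differentiable (at x within S)"
  by (auto simp: real_differentiable_def)

lemma second_derivative_nonpos_at_max:
  fixes g g1 :: "real \<Rightarrow> real"
  assumes d: "0 < d" and g: "\<And>x. \<bar>x - t\<bar> < d \<Longrightarrow> (g has_real_derivative g1 x) (at x)"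
    and g1: "(g1 has_real_derivative g2) (at t)"
    and max: "\<And>x. \<bar>x - t\<bar> < d \<Longrightarrow> g x \<le> g t"
  shows "g1 t = 0" "g2 \<le> 0"
proof -
  show g1t: "g1 t = 0"
    by (rule DERIV_local_max[OF g d]) (use d max in \<open>auto simp: abs_minus_commute\<close>)
  show "g2 \<le> 0"
  proof (rule ccontr)
    assume "\<not> g2 \<le> 0"
    then obtain e where e: "0 < e" "\<And>h. 0 < h \<Longrightarrow> h < e \<Longrightarrow> 0 < g1 (t + h)"
      using DERIV_pos_inc_right[OF g1] g1t by auto
    define b where "b = t + min d e / 2"
    have b: "t < b" "b < t + e" "\<bar>b - t\<bar> < d" using d e by (auto simp: b_def min_def)
    have "g t < g b"
    proof (rule DERIV_pos_imp_increasing_open[OF b(1)])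
      fix x assume "t < x" "x < b"
      then show "\<exists>D. (g has_real_derivative D) (at x) \<and> 0 < D"
        using e(2)[of "x - t"] b by (intro exI[of _ "g1 x"] conjI g) auto
    next
      show "continuous_on {t..b} g"
        using b by (intro continuous_at_imp_continuous_on ballI DERIV_isCont[OF g]) auto
    qed
    then show False using max[OF b(3)] by simp
  qed
qed

text \<open>Barta's argument with the positive comparison function \<open>1 / cosh (c t)\<close>:
  look at an interior maximum of the quotient.\<close>

lemma eigenvalue_lower_bound_pos:
  fixes f f1 V :: "real \<Rightarrow> real"
  assumes cont: "continuous_on {-1..1} f" and bc: "f (-1) = 0" "f 1 = 0"
    and f: "\<And>t. t \<in> {-1<..<1} \<Longrightarrow> (f has_real_derivative f1 t) (at t)"
    and f1: "\<And>t. t \<in> {-1<..<1} \<Longrightarrow> (f1 has_real_derivative - (V t + \<alpha>) * f t) (at t)"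
    and V: "\<And>t. t \<in> {-1<..<1} \<Longrightarrow> V t + c\<^sup>2 * (1 - 2 / (cosh (c * t))\<^sup>2) \<le> \<mu>"
    and s: "s \<in> {-1<..<1}" "0 < f s"
  shows "- \<mu> \<le> \<alpha>"
proof -
  \<comment> \<open>The quotient of f by h = sech (c t). Since h'' / h = c^2 (1 - 2 sech^2 (c t)),
    the hypothesis on V bounds V + h'' / h by \<mu>, and g' = 0, g'' <= 0 at the maximum give
    \<alpha> >= - (V + h'' / h).\<close>
  define g where "g t = f t * cosh (c * t)" for t
  have "continuous_on {-1..1} g"
    unfolding g_def by (intro continuous_intros cont)
  then obtain t where t: "t \<in> {-1..1}" and max: "\<And>x. x \<in> {-1..1} \<Longrightarrow> g x \<le> g t"
    using continuous_attains_sup[of "{-1..1}" g] by auto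
  have "0 < g s" using s by (simp add: g_def cosh_real_pos)
  also have "g s \<le> g t" using s by (intro max) auto
  finally have gt: "0 < g t" .
  then have ft: "0 < f t"
    unfolding g_def using cosh_real_pos by (rule zero_less_mult_pos2)
  with bc t have t': "t \<in> {-1<..<1}" by (cases "t = -1 \<or> t = 1") auto
  define g1 where "g1 x = f1 x * cosh (c * x) + c * f x * sinh (c * x)" for x
  define g2 where "g2 = - (V t + \<alpha>) * f t * cosh (c * t) + 2 * c * f1 t * sinh (c * t) + c\<^sup>2 * f t * cosh (c * t)"
  have d: "0 < 1 - \<bar>t\<bar>" using t' by auto
  have g: "(g has_real_derivative g1 x) (at x)" if "\<bar>x - t\<bar> < 1 - \<bar>t\<bar>" for x
  proof -
    have x: "x \<in> {-1<..<1}" using that by auto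
    show ?thesis unfolding g_def g1_def by (auto intro!: derivative_eq_intros f[OF x])
  qed
  have g1: "(g1 has_real_derivative g2) (at t)"
    unfolding g1_def g2_def
    by (auto intro!: derivative_eq_intros f[OF t'] f1[OF t'] simp: power2_eq_square algebra_simps)
  have gmax: "g x \<le> g t" if "\<bar>x - t\<bar> < 1 - \<bar>t\<bar>" for x
    using that by (intro max) auto
  have g1t: "g1 t = 0" and g2: "g2 \<le> 0"
    using second_derivative_nonpos_at_max[OF d g g1 gmax] by auto
  define C where "C = cosh (c * t)"
  define Sh where "Sh = sinh (c * t)"
  have C: "0 < C" by (simp add: C_def cosh_real_pos)
  have CS: "Sh\<^sup>2 = C\<^sup>2 - 1" by (simp add: C_def Sh_def cosh_square_eq)
  have f1t: "f1 t = - (c * f t * Sh) / C"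
    using g1t C by (simp add: g1_def C_def[symmetric] Sh_def[symmetric] field_simps)
  have "g2 = f t * C * (- (V t + \<alpha>) - 2 * c\<^sup>2 * (Sh\<^sup>2 / C\<^sup>2) + c\<^sup>2)"
    unfolding g2_def C_def[symmetric] Sh_def[symmetric] f1t using C
    by (simp add: field_simps power2_eq_square)
  also have "Sh\<^sup>2 / C\<^sup>2 = 1 - 1 / C\<^sup>2" using C by (simp add: CS diff_divide_distrib)
  finally have "- (V t + \<alpha>) - 2 * c\<^sup>2 * (1 - 1 / C\<^sup>2) + c\<^sup>2 \<le> 0"
    using g2 ft C by (simp add: mult_le_0_iff)
  then show ?thesis
    using V[OF t'] by (simp add: C_def[symmetric] algebra_simps)
qed

text \<open>The eigenfunction may change sign: one of f and -f is positive somewhere, which is all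
  the maximum argument requires.\<close>

lemma eigenvalue_lower_bound:
  assumes eig: "dirichlet_eigenvalue (linearized_operator p v) \<alpha>"
    and V: "\<And>t. t \<in> {-1<..<1} \<Longrightarrow> p * v t powr (p - 1) + c\<^sup>2 * (1 - 2 / (cosh (c * t))\<^sup>2) \<le> \<mu>"
  shows "- \<mu> \<le> \<alpha>"
proof -
  obtain f s where df: "dirichlet_function f" and s: "s \<in> {-1<..<1}" "f s \<noteq> 0"
    and eq: "\<And>t. t \<in> {-1<..<1} \<Longrightarrow> linearized_operator p v f t = \<alpha> * f t"
    using eig by (auto simp: dirichlet_eigenvalue_def)
  have cont: "continuous_on {-1..1} f" and bc: "f (-1) = 0" "f 1 = 0"
    using df by (auto simp: dirichlet_function_def)
  have f: "(f has_real_derivative deriv f t) (at t)"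
    and f1: "(deriv f has_real_derivative - (p * v t powr (p - 1) + \<alpha>) * f t) (at t)"
    if "t \<in> {-1<..<1}" for t
  proof -
    have "f differentiable (at t)" "deriv f differentiable (at t)"
      using df that by (auto simp: dirichlet_function_def twice_differentiable_on_def)
    moreover have "deriv (deriv f) t = - (p * v t powr (p - 1) + \<alpha>) * f t"
      using eq[OF that] by (simp add: linearized_operator_def algebra_simps)
    ultimately show "(f has_real_derivative deriv f t) (at t)"
      "(deriv f has_real_derivative - (p * v t powr (p - 1) + \<alpha>) * f t) (at t)"
      by (metis DERIV_deriv_iff_real_differentiable)+
  qed
  show ?thesis
  proof (cases "0 < f s")
    case True
    then show ?thesis
      using eigenvalue_lower_bound_pos[of f "deriv f" "\<lambda>t. p * v t powr (p - 1)", OF cont bc f f1 V s(1)] by simp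
  next
    case False
    have "((\<lambda>x. - deriv f x) has_real_derivative - (p * v t powr (p - 1) + \<alpha>) * - f t) (at t)"
      if "t \<in> {-1<..<1}" for t
      using DERIV_minus[OF f1[OF that]] by simp
    then show ?thesis
      using eigenvalue_lower_bound_pos[of "\<lambda>x. - f x" "\<lambda>x. - deriv f x" "\<lambda>t. p * v t powr (p - 1)",
          OF continuous_on_minus[OF cont] _ _ DERIV_minus[OF f] _ V s(1)] bc s False by simp
  qed
qed

lemma dirichlet_eigenvalueI:
  assumes y: "\<And>x. x \<in> {-1..1} \<Longrightarrow> (y has_real_derivative y1 x) (at x)"
    and y1: "\<And>x. x \<in> {-1..1} \<Longrightarrow> (y1 has_real_derivative - (p * v x powr (p - 1) + b) * y x) (at x)"
    and bc: "y (-1) = 0" "y 1 = 0" and y0: "y 0 \<noteq> 0"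
  shows "dirichlet_eigenvalue (linearized_operator p v) b"
proof -
  have dy: "deriv y x = y1 x" if "x \<in> {-1..1}" for x
    using y[OF that] by (rule DERIV_imp_deriv)
  have ddy: "(deriv y has_real_derivative - (p * v x powr (p - 1) + b) * y x) (at x)"
    if x: "x \<in> {-1<..<1}" for x
  proof (rule has_field_derivative_transform_within_open)
    show "(y1 has_real_derivative - (p * v x powr (p - 1) + b) * y x) (at x)"
      using x by (intro y1) auto
    show "open {-1<..<1::real}" by simp
  qed (use x dy in auto)
  show ?thesis
    unfolding dirichlet_eigenvalue_def
  proof (intro exI[of _ y] conjI ballI)
    show "dirichlet_function y"
      unfolding dirichlet_function_def twice_differentiable_on_def
    proof (intro conjI ballI)
      show "continuous_on {-1..1} y"
        by (intro continuous_at_imp_continuous_on ballI DERIV_isCont[OF y])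
      fix t :: real assume t: "t \<in> {-1<..<1}"
      then show "y differentiable (at t)"
        using y[of t] by (auto simp: real_differentiable_def)
      show "deriv y differentiable (at t)"
        using ddy[OF t] by (auto simp: real_differentiable_def)
    qed (use bc in auto)
    show "\<exists>t\<in>{-1<..<1}. y t \<noteq> 0" using y0 by (intro bexI[of _ 0]) auto
    fix t :: real assume t: "t \<in> {-1<..<1}"
    show "linearized_operator p v y t = b * y t"
      unfolding linearized_operator_def DERIV_imp_deriv[OF ddy[OF t]] by (simp add: algebra_simps)
  qed
qed

section \<open>The linearized operator at the Lane-Emden solution\<close>

context lane_emden
begin

lemma p_M_powr: "p * M powr (p - 1) = c\<^sup>2 * (2 - 1 / k)"
proof -
  have "2 - 1 / k = (2 * k - 1) / k" using k_gt1 by (simp add: field_simps)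
  then show ?thesis unfolding M_powr two_k by simp
qed

text \<open>The power (u/M)^(p+1) equals 1 - w^2 and is at most sech^2 by \<open>w_lower\<close>.
  Passing to the exponent p - 1, which is the factor 1 - 1/k, costs the additive 1/k.\<close>

lemma potential_upper:
  assumes x: "x \<in> {-1<..<1}"
  shows "p * u x powr (p - 1) \<le> 2 * c\<^sup>2 * (1 / (cosh (c * x))\<^sup>2 + 1 / k)"
proof -
  define y where "y = \<bar>x\<bar>"
  have y: "y \<in> {0..1}" "y \<in> {-1<..<1}" "y \<in> {-1..1}" using x by (auto simp: y_def)
  have uxy: "u x = u y"
    using u_even_and_le(1)[of x] x by (auto simp: y_def abs_if)
  have cxy: "cosh (c * x) = cosh (c * y)"
    using cosh_minus[of "c * x"] by (simp add: y_def abs_if)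
  define \<sigma> where "\<sigma> = 1 / (cosh (c * y))\<^sup>2"
  define \<tau> where "\<tau> = (u y / M) powr (p + 1)"
  have uM: "0 < u y / M" using u_pos[OF y(2)] M_pos by simp
  have \<tau>0: "0 < \<tau>" using u_pos[OF y(2)] M_pos by (simp add: \<tau>_def)
  have \<sigma>0: "0 \<le> \<sigma>" by (simp add: \<sigma>_def)
  have "\<tau> = 1 - (w y)\<^sup>2"
    unfolding one_minus_w_sq[OF y(1)] k_a_sq \<tau>_def
    using u_pos[OF y(2)] M_pos by (simp add: powr_divide)
  also have "\<dots> \<le> 1 - (tanh (c * y))\<^sup>2"
    using w_lower[OF y(1)] c_pos y by (auto intro!: power_mono)
  also have "\<dots> = \<sigma>"
  proof -
    have "cosh (c * y) \<noteq> 0" using cosh_real_pos[of "c * y"] by linarith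
    then show ?thesis
      unfolding \<sigma>_def tanh_def power_divide sinh_square_eq by (simp add: field_simps)
  qed
  finally have \<tau>\<sigma>: "\<tau> \<le> \<sigma>" .
  have "(u y / M) powr (p - 1) = \<tau> powr (1 - 1 / k) * 1 powr (1 / k)"
  proof -
    have "(p + 1) * (1 - 1 / k) = p - 1" using p by (simp add: k_def field_simps)
    then show ?thesis by (simp add: \<tau>_def powr_powr)
  qed
  \<comment> \<open>Young's inequality between \<tau> and 1 with weights 1 - 1/k and 1/k; the factor
    \<open>1 powr (1 / k)\<close> was inserted for this purpose.\<close>
  also have "\<dots> \<le> (1 - 1 / k) * \<tau> + 1 / k * 1"
    using k_gt1 \<tau>0 by (intro Youngs_inequality_0) auto
  also have "\<dots> \<le> \<sigma> + 1 / k"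
  proof -
    have "(1 - 1 / k) * \<tau> \<le> 1 * \<tau>" using k_gt1 \<tau>0 by (intro mult_right_mono) auto
    then show ?thesis using \<tau>\<sigma> by linarith
  qed
  finally have b: "(u y / M) powr (p - 1) \<le> \<sigma> + 1 / k" .
  have "p * u y powr (p - 1) = (p * M powr (p - 1)) * (u y / M) powr (p - 1)"
    using u_pos[OF y(2)] M_pos by (simp add: powr_divide)
  also have "\<dots> \<le> (c\<^sup>2 * 2) * (\<sigma> + 1 / k)"
    unfolding p_M_powr using b k_gt1 \<sigma>0
    by (intro mult_mono mult_left_mono) (auto simp: field_simps)
  also have "c\<^sup>2 * 2 = 2 * c\<^sup>2" by simp
  finally show ?thesis unfolding uxy cxy \<sigma>_def .
qed

text \<open>The sech^2 term of \<open>potential_upper\<close> cancels the one in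
  \<open>eigenvalue_lower_bound\<close> exactly, leaving a constant.\<close>

lemma eigenvalue_ge:
  assumes eig: "dirichlet_eigenvalue (linearized_operator p v) \<alpha>"
  shows "- (c\<^sup>2 * (1 + 2 / k)) \<le> \<alpha>"
proof (rule eigenvalue_lower_bound[OF eig])
  fix t :: real assume t: "t \<in> {-1<..<1}"
  show "p * v t powr (p - 1) + c\<^sup>2 * (1 - 2 / (cosh (c * t))\<^sup>2) \<le> c\<^sup>2 * (1 + 2 / k)"
    using potential_upper[OF t] v[of t] t by (simp add: algebra_simps)
qed

text \<open>The power \<open>u\<^sup>k\<close> is an exact eigenfunction up to the weight \<open>u\<^sup>-\<^sup>2\<close>: with the energy identity,
  \<open>(u\<^sup>k)'' + p u\<^sup>p\<^sup>-\<^sup>1 u\<^sup>k = k (k - 1) a\<^sup>2 u\<^sup>k\<^sup>-\<^sup>2\<close>.\<close>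

lemma exists_eigenvalue_le:
  shows "\<exists>b \<le> - ((k - 1) * (c\<^sup>2 / k)). dirichlet_eigenvalue (linearized_operator p v) b"
proof -
  \<comment> \<open>Clamped because the shooting lemma asks for a potential that is continuous, even
    and bounded on the whole line.\<close>
  define V where "V x = p * u (max (-1) (min 1 x)) powr (p - 1)" for x
  define \<phi> where "\<phi> x = u x powr k" for x
  define \<phi>1 where "\<phi>1 x = k * u x powr (k - 1) * u1 x" for x
  define \<phi>2 where "\<phi>2 x = k * ((k - 1) * u x powr (k - 1 - 1) * u1 x * u1 x + u x powr (k - 1) * - (u x powr p))" for x
  \<comment> \<open>Dividing \<phi>'' + V \<phi> by \<phi> gives k (k - 1) a^2 / u^2, whose least
    value, taken at u = M, is (k - 1) M^(p-1).\<close>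
  define \<beta> where "\<beta> = - ((k - 1) * M powr (p - 1))"
  have "\<exists>b\<le>\<beta>. \<exists>y y1. y 0 = 1 \<and> y 1 = 0 \<and> y (-1) = 0 \<and>
    (\<forall>x\<in>{-1..1}. (y has_real_derivative y1 x) (at x) \<and>
                 (y1 has_real_derivative - (V x + b) * y x) (at x))"
  proof (rule exists_even_dirichlet_solution)
    have clamp: "max (-1) (min 1 x) \<in> {-1..1}" for x :: real by auto
    show "continuous_on UNIV V"
      unfolding V_def
      by (intro continuous_on_mult continuous_on_powr' continuous_on_compose2[OF continuous_on_u[of UNIV]] continuous_intros)
        (use u_nonneg[OF clamp] p in auto)
    show "0 \<le> V x" for x using p by (simp add: V_def)
    show "V x \<le> p * M powr (p - 1)" for x
      unfolding V_def M_def using p u_nonneg[OF clamp] u_even_and_le(2)[OF clamp]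
      by (intro mult_left_mono powr_mono2) auto
    show "V (- x) = V x" for x
    proof -
      have "max (-1) (min 1 (- x)) = - max (-1) (min 1 x)" by (auto simp: max_def min_def)
      then show ?thesis unfolding V_def using u_even_and_le(1)[OF clamp] by simp
    qed
    show "continuous_on {0..1} \<phi>"
      unfolding \<phi>_def using k_gt1 u_nonneg
      by (intro continuous_on_powr' continuous_on_u continuous_intros) auto
    show "\<phi> 1 = 0" by (simp add: \<phi>_def u_right)
    show "\<phi>1 0 = 0" by (simp add: \<phi>1_def u1_0)
    fix x :: real assume x: "x \<in> {0..<1}"
    then have x': "x \<in> {-1<..<1}" "x \<in> {-1..1}" "x \<in> {0..1}" by auto
    have ux: "0 < u x" by (rule u_pos[OF x'(1)])
    show "0 < \<phi> x" using ux by (simp add: \<phi>_def)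
    show "(\<phi> has_real_derivative \<phi>1 x) (at x)"
      unfolding \<phi>_def \<phi>1_def using DERIV_fun_powr[OF u ux, of k] by simp
    have "((\<lambda>x. k * (u x powr (k - 1) * u1 x)) has_real_derivative \<phi>2 x) (at x)"
      unfolding \<phi>2_def
      using DERIV_cmult[OF DERIV_mult[OF DERIV_fun_powr[OF u ux, of "k - 1"] u1[OF x'(2)]], of k]
      by (simp add: algebra_simps)
    moreover have "\<phi>1 = (\<lambda>x. k * (u x powr (k - 1) * u1 x))"
      by (simp add: \<phi>1_def fun_eq_iff)
    ultimately show "(\<phi>1 has_real_derivative \<phi>2 x) (at x)" by simp
    define z where "z = u x powr (k - 2)"
    have z: "0 < z" using ux by (simp add: z_def)
    define X where "X = u x powr (p + 1)"
    have e1: "u x powr (k - 1) * u x powr p = z * X"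
      unfolding z_def X_def powr_add[symmetric]
      by (rule arg_cong[where f = "\<lambda>r. u x powr r"]) simp
    have e2: "u x powr (p - 1) * u x powr k = z * X"
      unfolding z_def X_def powr_add[symmetric]
      by (rule arg_cong[where f = "\<lambda>r. u x powr r"]) simp
    have e3: "u x powr k = z * (u x)\<^sup>2"
      using ux unfolding z_def by (simp add: powr_diff powr_numeral)
    have "u1 x * u1 x = a\<^sup>2 - X / k"
      using energy[OF x'(3)] by (simp add: X_def power2_eq_square)
    moreover have "\<phi>2 x = k * ((k - 1) * z * (u1 x * u1 x) - u x powr (k - 1) * u x powr p)"
      by (simp add: \<phi>2_def z_def)
    ultimately have \<phi>2: "\<phi>2 x = k * ((k - 1) * z * (a\<^sup>2 - X / k) - z * X)"
      by (simp only: e1)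
    have Vx: "V x = p * u x powr (p - 1)" using x by (simp add: V_def)
    have "\<phi>2 x + (V x + \<beta>) * \<phi> x =
        k * ((k - 1) * z * (a\<^sup>2 - X / k) - z * X) + p * (z * X) + \<beta> * (z * (u x)\<^sup>2)"
    proof -
      have A: "V x * \<phi> x = p * (z * X)"
        using e2 Vx by (simp add: \<phi>_def mult.assoc)
      have B: "\<phi> x = z * (u x)\<^sup>2" using e3 by (simp add: \<phi>_def)
      show ?thesis
        unfolding \<phi>2 distrib_right A by (simp only: B add.assoc)
    qed
    also have "\<dots> = (k - 1) * z * (k * a\<^sup>2 - M powr (p - 1) * (u x)\<^sup>2)"
    proof -
      \<comment> \<open>With all powers as free variables this is polynomial algebra. The terms in z
        X cancel because -(r - 1) - r + (2 r - 1) = 0, which is why the exponent k = (p + 1) / 2 is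
        the right one.\<close>
      have "r * ((r - 1) * z * (A - X / r) - z * X) + (2 * r - 1) * (z * X) + - ((r - 1) * m) * (z * U)
          = (r - 1) * z * (r * A - m * U)" if "r \<noteq> 0" for r A m U :: real
        using that by (simp add: field_simps)
      from this[of k "a\<^sup>2" "M powr (p - 1)" "(u x)\<^sup>2"] show ?thesis
        unfolding \<beta>_def two_k using k_gt1 by auto
    qed
    also have "k * a\<^sup>2 = M powr (p - 1) * M\<^sup>2"
      using M_pos unfolding k_a_sq by (simp add: add.commute flip: powr_numeral powr_add)
    finally have "\<phi>2 x + (V x + \<beta>) * \<phi> x = (k - 1) * z * (M powr (p - 1) * (M\<^sup>2 - (u x)\<^sup>2))"
      by (simp add: algebra_simps)
    moreover have "(u x)\<^sup>2 \<le> M\<^sup>2"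
      using ux u_even_and_le(2)[OF x'(2)] by (intro power_mono) (auto simp: M_def)
    ultimately show "0 \<le> \<phi>2 x + (V x + \<beta>) * \<phi> x"
      using z k_gt1 by simp
  qed
  then obtain b y y1 where b: "b \<le> \<beta>" and y0: "y 0 = 1" "y 1 = 0" "y (-1) = 0"
    and y: "\<And>x. x \<in> {-1..1} \<Longrightarrow> (y has_real_derivative y1 x) (at x)"
      "\<And>x. x \<in> {-1..1} \<Longrightarrow> (y1 has_real_derivative - (V x + b) * y x) (at x)"
    by blast
  have "V x = p * v x powr (p - 1)" if "x \<in> {-1..1}" for x
    using that v[OF that] by (simp add: V_def)
  then have "dirichlet_eigenvalue (linearized_operator p v) b"
    using y y0 by (intro dirichlet_eigenvalueI[of y y1]) auto
  then show ?thesis using b by (auto simp: \<beta>_def M_powr)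
qed

end

section \<open>The Liouville profile and its uniqueness\<close>

lemma profile_eq: "profile s = - 2 * ln (cosh (s / sqrt 2))"
proof -
  define y where "y = s / sqrt 2"
  have s: "sqrt 2 * s = 2 * y" by (simp add: y_def field_simps)
  have "1 + exp (2 * y) = 2 * exp y * cosh y"
    unfolding cosh_def exp_double power2_eq_square by (simp add: distrib_left exp_minus)
  then have "4 * exp (2 * y) / (1 + exp (2 * y))\<^sup>2 = 4 * (exp y)\<^sup>2 / (2 * exp y * cosh y)\<^sup>2"
    by (simp add: exp_double)
  also have "\<dots> = 1 / (cosh y)\<^sup>2" by (simp add: power_mult_distrib)
  finally show ?thesis
    by (simp add: profile_def s ln_div ln_realpow cosh_real_pos flip: y_def)
qed

lemma profile_has_derivative: "(profile has_real_derivative - sqrt 2 * tanh (s / sqrt 2)) (at s)"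
proof -
  have "((\<lambda>s. - 2 * ln (cosh (s / sqrt 2))) has_real_derivative
      - 2 * (1 / cosh (s / sqrt 2) * (sinh (s / sqrt 2) * (1 / sqrt 2)))) (at s)"
  proof (rule DERIV_cmult, rule DERIV_chain2[where f = ln])
    show "((\<lambda>s. cosh (s / sqrt 2)) has_real_derivative sinh (s / sqrt 2) * (1 / sqrt 2)) (at s)"
      by (rule has_field_derivative_cosh[OF DERIV_cdivide[OF DERIV_ident]])
  qed (rule DERIV_ln_divide[OF cosh_real_pos])
  moreover have "- 2 * (1 / C * (S * (1 / r))) = - (2 / r) * (S / C)" for C S r :: real by simp
  ultimately show ?thesis unfolding profile_eq[abs_def] tanh_def by (simp only: real_div_sqrt[of 2])
qed

lemma exp_profile: "exp (profile s) = 1 - (tanh (s / sqrt 2))\<^sup>2"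
proof -
  have C: "0 < cosh (s / sqrt 2)" by (rule cosh_real_pos)
  have "exp (profile s) = inverse ((exp (ln (cosh (s / sqrt 2))))\<^sup>2)"
    unfolding profile_eq by (simp add: exp_minus exp_double)
  then show ?thesis
    using C by (simp add: tanh_def power_divide sinh_square_eq field_simps)
qed

lemma profile_has_second_derivative:
  "((\<lambda>s. - sqrt 2 * tanh (s / sqrt 2)) has_real_derivative - exp (profile s)) (at s)"
proof -
  have "cosh (s / sqrt 2) \<noteq> 0" using cosh_real_pos[of "s / sqrt 2"] by linarith
  then show ?thesis
    unfolding exp_profile by (auto intro!: derivative_eq_intros simp: field_simps)
qed

lemma deriv_profile: "deriv profile = (\<lambda>s. - sqrt 2 * tanh (s / sqrt 2))"
  using DERIV_imp_deriv[OF profile_has_derivative] by blast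

lemma exp_lipschitz:
  fixes x y C :: real
  assumes "x \<le> C" "y \<le> C"
  shows "\<bar>exp x - exp y\<bar> \<le> exp C * \<bar>x - y\<bar>"
  using assms
proof (induction x y rule: linorder_wlog)
  case (le x y)
  have "exp y - exp x \<le> exp C * y - exp C * x"
    by (rule derivative_mono_imp_le[where f' = exp and g' = "\<lambda>_. exp C"])
      (use le in \<open>auto intro!: derivative_eq_intros\<close>)
  then show ?case using le by (simp add: abs_minus_commute[of "exp x"] abs_minus_commute[of x] algebra_simps)
next
  case (sym x y)
  then show ?case by (simp add: abs_minus_commute)
qed

lemma liouville_solution_iff: "liouville_solution V \<longleftrightarrow> V = profile"
proof
  assume V: "V = profile"
  show "liouville_solution V"
    unfolding liouville_solution_def twice_differentiable_on_def V deriv_profile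
  proof (intro conjI ballI allI)
    fix s :: real
    show "profile differentiable at s"
      using profile_has_derivative by (rule real_differentiableI)
    show "(\<lambda>s. - sqrt 2 * tanh (s / sqrt 2)) differentiable at s"
      using profile_has_second_derivative by (rule real_differentiableI)
    show "- deriv (\<lambda>s. - sqrt 2 * tanh (s / sqrt 2)) s = exp (profile s)"
      by (simp only: DERIV_imp_deriv[OF profile_has_second_derivative] minus_minus)
  qed (simp_all add: profile_eq)
next
  assume V: "liouville_solution V"
  then have V': "(V has_real_derivative deriv V x) (at x)"
    and V'': "(deriv V has_real_derivative - exp (V x)) (at x)" for x
  proof -
    have "V differentiable (at x)" "deriv V differentiable (at x)" "deriv (deriv V) x = - exp (V x)"
      using V by (auto simp: liouville_solution_def twice_differentiable_on_def minus_equation_iff)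
    then show "(V has_real_derivative deriv V x) (at x)"
      "(deriv V has_real_derivative - exp (V x)) (at x)"
      by (metis DERIV_deriv_iff_real_differentiable)+
  qed
  have V0: "deriv V 0 = 0" "V 0 = 0" using V by (auto simp: liouville_solution_def)
  show "V = profile"
  proof
    fix s :: real
    define R where "R = \<bar>s\<bar>"
    \<comment> \<open>The exponential is Lipschitz only below a bound, so a common upper bound C for
      both solutions on the compact interval is extracted first.\<close>
    have "continuous_on {-R..R} (\<lambda>x. max (V x) (profile x))"
      by (intro continuous_on_max continuous_at_imp_continuous_on ballI
          DERIV_isCont[OF V'] DERIV_isCont[OF profile_has_derivative])
    then have "\<exists>t\<in>{-R..R}. \<forall>x\<in>{-R..R}. max (V x) (profile x) \<le> max (V t) (profile t)"
      by (intro continuous_attains_sup) (auto simp: R_def)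
    then obtain t where "\<And>x. x \<in> {-R..R} \<Longrightarrow> max (V x) (profile x) \<le> max (V t) (profile t)"
      by blast
    moreover define C where "C = max (V t) (profile t)"
    ultimately have C: "V x \<le> C" "profile x \<le> C" if "\<bar>x\<bar> \<le> R" for x
      using that by (auto simp: abs_le_iff minus_le_iff)
    have "V s - profile s = 0"
    proof (rule second_order_unique[where d = "\<lambda>x. V x - profile x" and L = "exp C" and R = R])
      fix x assume x: "\<bar>x\<bar> \<le> R"
      show "((\<lambda>x. V x - profile x) has_real_derivative deriv V x - - sqrt 2 * tanh (x / sqrt 2)) (at x)"
        by (intro DERIV_diff V' profile_has_derivative)
      show "((\<lambda>x. deriv V x - - sqrt 2 * tanh (x / sqrt 2)) has_real_derivative
          - exp (V x) - - exp (profile x)) (at x)"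
        by (intro DERIV_diff V'' profile_has_second_derivative)
      show "\<bar>- exp (V x) - - exp (profile x)\<bar> \<le> exp C * \<bar>V x - profile x\<bar>"
        using exp_lipschitz[OF C[OF x]] by (simp add: abs_minus_commute)
    qed (auto simp: V0 profile_eq R_def)
    then show "V s = profile s" by simp
  qed
qed

section \<open>Convergence\<close>

lemma uniform_limit_of_bound:
  fixes f :: "'i \<Rightarrow> real \<Rightarrow> real"
  assumes e: "(e \<longlongrightarrow> 0) F" and le: "\<forall>\<^sub>F i in F. \<forall>x\<in>K. \<bar>f i x - g x\<bar> \<le> e i"
  shows "uniform_limit K f g F"
proof (rule uniform_limitI)
  fix r :: real assume "0 < r"
  with e have "\<forall>\<^sub>F i in F. e i < r" by (rule order_tendstoD)
  with le show "\<forall>\<^sub>F i in F. \<forall>x\<in>K. dist (f i x) (g x) < r"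
    by eventually_elim (force simp: dist_real_def)
qed

lemma vector_derivative_withinI:
  fixes f :: "real \<Rightarrow> real"
  assumes "(f has_real_derivative D) (at x within S)" "x islimpt S"
  shows "vector_derivative f (at x within S) = D"
  using assms by (intro vector_derivative_within)
    (auto simp: trivial_limit_within simp flip: has_real_derivative_iff_has_vector_derivative)

lemma C1_onI:
  fixes f :: "real \<Rightarrow> real"
  assumes f: "\<And>x. x \<in> S \<Longrightarrow> (f has_real_derivative f1 x) (at x within S)"
    and f1: "continuous_on S f1" and S: "\<And>x. x \<in> S \<Longrightarrow> x islimpt S"
  shows "C1_on S f"
  unfolding C1_on_def
proof
  show "f differentiable_on S"
    unfolding differentiable_on_def using real_differentiableI[OF f] by blast
  show "continuous_on S (\<lambda>t. vector_derivative f (at t within S))"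
    using f1 by (rule continuous_on_eq) (simp add: vector_derivative_withinI[OF f S])
qed

lemma tanh_real_lipschitz: "\<bar>tanh x - tanh y\<bar> \<le> \<bar>x - y\<bar>" for x y :: real
proof (induction x y rule: linorder_wlog)
  case (le x y)
  have "tanh y - tanh x \<le> y - x"
    by (rule derivative_mono_imp_le[where f' = "\<lambda>z. 1 - (tanh z)\<^sup>2" and g' = "\<lambda>_. 1"])
      (use le in \<open>auto intro!: derivative_eq_intros\<close>)
  then show ?case using le by simp
next
  case (sym x y)
  then show ?case by (simp add: abs_minus_commute)
qed

lemma profile_minus: "profile (- s) = profile s"
  using cosh_minus[of "s / sqrt 2"] by (simp add: profile_eq)

section \<open>Transfer to the given solution and explicit blow-up estimates\<close>

context lane_emden
begin

lemma sup_norm_eq: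
  shows "sup_norm v = M"
  unfolding sup_norm_def
proof (rule cSup_eq_maximum)
  show "M \<in> (\<lambda>t. \<bar>v t\<bar>) ` {-1..1}"
    using M_pos v[of 0] by (auto simp: M_def intro!: image_eqI[of _ _ 0])
  fix y assume "y \<in> (\<lambda>t. \<bar>v t\<bar>) ` {-1..1}"
  then show "y \<le> M"
    using u_even_and_le(2) u_nonneg by (auto simp: M_def simp flip: v)
qed

lemma solution_has_derivative:
  assumes x: "x \<in> {-1..1}"
  shows "(v has_real_derivative u1 x) (at x within {-1..1})"
  by (rule has_field_derivative_transform_within[OF has_field_derivative_at_within[OF u] zero_less_one x])
    (use v in auto)

lemma solution_C1_on:
  shows "C1_on {-1..1} v"
  by (rule C1_onI[OF solution_has_derivative])
    (auto simp: islimpt_Icc intro!: continuous_at_imp_continuous_on DERIV_isCont[OF u1])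

text \<open>At distance at least d from the origin w lies between tanh (d c) and 1, so the slope is
  within a (1 - tanh (d c)) of a in absolute value; a itself is compared with 1.\<close>

lemma derivative_estimate:
  assumes d: "0 < d" "d \<le> \<bar>x\<bar>" and x: "x \<in> {-1..1}"
  shows "\<bar>u1 x + sgn x\<bar> \<le> \<bar>a - 1\<bar> + a * (1 - tanh (d * c))"
proof -
  have *: "\<bar>u1 y + 1\<bar> \<le> \<bar>a - 1\<bar> + a * (1 - tanh (d * c))" if y: "d \<le> y" "y \<le> 1" for y
  proof -
    have y': "y \<in> {0..1}" using y d by auto
    have "tanh (d * c) \<le> tanh (c * y)" using y c_pos by (simp add: mult.commute)
    also have "\<dots> \<le> w y" by (rule w_lower[OF y'])
    finally have "a * tanh (d * c) \<le> - u1 y" using a_pos by (simp add: w_def field_simps)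
    then show ?thesis using u1_ge[OF y'] by (simp add: algebra_simps abs_le_iff)
  qed
  show ?thesis
  proof (cases "0 \<le> x")
    case True
    then show ?thesis using *[of x] d x by (auto simp: sgn_if)
  next
    case False
    then show ?thesis using *[of "- x"] d x u1_odd[of "- x"] by (auto simp: sgn_if abs_minus_commute)
  qed
qed

text \<open>Chosen so that the blow-up scale is gam / c: by \<open>M_powr\<close>, p M^(p-1) = p c^2
  / k = (c / gam)^2. Hence c x becomes gam s under x = mu s, and gam tends to 1 / sqrt 2.\<close>

definition gam :: real where "gam = sqrt (k / p)"
definition mu :: real where "mu = gam / c"

lemma gam_pos: "0 < gam" using p k_gt1 by (simp add: gam_def)

lemma mu_pos: "0 < mu" using gam_pos c_pos by (simp add: mu_def)

lemma blowup_scale_eq: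
  shows "blowup_scale p v = mu"
proof -
  have "blowup_scale p v = inverse (sqrt (p * (c\<^sup>2 / k)))"
    unfolding blowup_scale_def sup_norm_eq M_powr
    using p c_pos k_gt1 by (simp add: powr_minus powr_half_sqrt)
  also have "\<dots> = mu"
    using p c_pos k_gt1 by (simp add: mu_def gam_def real_sqrt_mult real_sqrt_divide field_simps)
  finally show ?thesis .
qed

lemma rescaled_eq:
  assumes s: "s \<in> {- 1 / mu..1 / mu}"
  shows "rescaled p v s = p * (u (mu * s) - M) / M"
proof -
  have "mu * s \<in> {-1..1}" using s mu_pos by (auto simp: field_simps)
  then show ?thesis
    unfolding rescaled_def blowup_scale_eq using v[of 0] v[of "mu * s"] by (simp add: M_def)
qed

lemma blowup_derivative: "((\<lambda>s. p * (u (mu * s) - M) / M) has_real_derivative - w (mu * s) / gam) (at s)"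
proof -
  have "((\<lambda>s. u (mu * s)) has_real_derivative u1 (mu * s) * mu) (at s)"
    by (rule DERIV_chain2[OF u DERIV_cmult_Id])
  then have "((\<lambda>s. p * (u (mu * s) - M) / M) has_real_derivative p * (u1 (mu * s) * mu - 0) / M) (at s)"
    by (intro DERIV_cdivide DERIV_cmult DERIV_diff DERIV_const)
  moreover have "p * (u1 (mu * s) * mu - 0) / M = - w (mu * s) / gam"
  proof -
    have g: "gam * gam * p = k" using p k_gt1 by (simp add: gam_def)
    have "u1 (mu * s) = - a * w (mu * s)" using a_pos by (simp add: w_def)
    then have "p * (u1 (mu * s) * mu - 0) / M = - w (mu * s) * (gam * p * (a / (c * M)))"
      by (simp add: mu_def)
    also have "a / (c * M) = 1 / k" using M_pos c_pos k_gt1 by (simp add: a_eq)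
    also have "gam * p * (1 / k) = 1 / gam"
      using gam_pos k_gt1 g by (simp add: field_simps)
    finally show ?thesis by simp
  qed
  ultimately show ?thesis by simp
qed

lemma rescaled_has_derivative:
  assumes s: "s \<in> {- 1 / mu..1 / mu}"
  shows "(rescaled p v has_real_derivative - w (mu * s) / gam) (at s within {- 1 / mu..1 / mu})"
  by (rule has_field_derivative_transform_within[OF has_field_derivative_at_within[OF blowup_derivative] zero_less_one s])
    (use rescaled_eq in auto)

lemma islimpt_blowup_domain: "s \<in> {- 1 / mu..1 / mu} \<Longrightarrow> s islimpt {- 1 / mu..1 / mu}"
  using mu_pos by (subst islimpt_Icc) (auto simp: field_simps)

lemma rescaled_C1_on:
  shows "C1_on {- 1 / mu..1 / mu} (rescaled p v)"
proof (rule C1_onI[OF rescaled_has_derivative _ islimpt_blowup_domain])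
  have "continuous_on {-1..1} u1"
    by (intro continuous_at_imp_continuous_on ballI DERIV_isCont[OF u1])
  then have "continuous_on {- 1 / mu..1 / mu} (\<lambda>s. u1 (mu * s))"
    by (rule continuous_on_compose2) (use mu_pos in \<open>auto intro!: continuous_intros simp: field_simps\<close>)
  then show "continuous_on {- 1 / mu..1 / mu} (\<lambda>s. - w (mu * s) / gam)"
    unfolding w_def using a_pos gam_pos by (intro continuous_intros) auto
qed

text \<open>The first summand bounds, for arguments up to S, the gap between w (mu s) and tanh (s /
  sqrt 2), divided by gam; the second replaces the prefactor 1 / gam by sqrt 2.\<close>

definition blowup_error :: "real \<Rightarrow> real" where
  "blowup_error S = S * (gam * (1 / (1 - 2 * mu * S) - 1) + \<bar>gam - 1 / sqrt 2\<bar>) / gam + \<bar>1 / gam - sqrt 2\<bar>"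

text \<open>For s >= 0, w (mu s) lies between tanh (gam s) and tanh (gam s / (1 - 2 mu s)), and tanh
  is 1-Lipschitz. The condition on S keeps the denominator positive; negative s follow by
  oddness.\<close>

lemma blowup_derivative_estimate:
  assumes S: "2 * mu * S < 1" and s: "\<bar>s\<bar> \<le> S"
  shows "\<bar>- w (mu * s) / gam - - sqrt 2 * tanh (s / sqrt 2)\<bar> \<le> blowup_error S"
proof -
  define E where "E = S * (gam * (1 / (1 - 2 * mu * S) - 1) + \<bar>gam - 1 / sqrt 2\<bar>)"
  have nonneg: "\<bar>w (mu * r) - tanh (r / sqrt 2)\<bar> \<le> E" if r: "0 \<le> r" "r \<le> S" for r
  proof -
    have mr: "2 * mu * r \<le> 2 * mu * S" using r mu_pos by simp
    then have "2 * (mu * r) < 1" using S by simp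
    then have mr': "0 \<le> mu * r" "mu * r < 1 / 2" using r mu_pos by simp_all
    have cm: "c * (mu * r) = gam * r" using c_pos by (simp add: mu_def)
    have lo: "tanh (gam * r) \<le> w (mu * r)"
      using w_lower[of "mu * r"] mr' unfolding cm by simp
    have up: "w (mu * r) \<le> tanh (gam * r / (1 - 2 * (mu * r)))"
      using w_upper[OF mr'] unfolding cm .
    have "\<bar>gam * r - r / sqrt 2\<bar> = r * \<bar>gam - 1 / sqrt 2\<bar>"
    proof -
      have "gam * r - r / sqrt 2 = r * (gam - 1 / sqrt 2)" by (simp add: algebra_simps)
      then show ?thesis using r by (simp only: abs_mult abs_of_nonneg)
    qed
    also have "\<dots> \<le> S * \<bar>gam - 1 / sqrt 2\<bar>" using r by (intro mult_right_mono) auto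
    finally have 1: "\<bar>gam * r - r / sqrt 2\<bar> \<le> S * \<bar>gam - 1 / sqrt 2\<bar>" .
    have i: "1 / (1 - 2 * (mu * r)) \<le> 1 / (1 - 2 * mu * S)" "1 \<le> 1 / (1 - 2 * mu * S)"
      using mr mr' S r mu_pos by (auto intro!: divide_left_mono simp: field_simps)
    have i': "1 \<le> 1 / (1 - 2 * (mu * r))" using mr' by (simp add: field_simps)
    have "gam * r / (1 - 2 * (mu * r)) - gam * r = r * (gam * (1 / (1 - 2 * (mu * r)) - 1))"
      by (simp add: algebra_simps)
    also have "\<dots> \<le> S * (gam * (1 / (1 - 2 * mu * S) - 1))"
      using r gam_pos i i' by (intro mult_mono mult_left_mono mult_nonneg_nonneg) auto
    finally have 2: "gam * r / (1 - 2 * (mu * r)) - gam * r \<le> S * (gam * (1 / (1 - 2 * mu * S) - 1))" .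
    have "gam * r / 1 \<le> gam * r / (1 - 2 * (mu * r))"
      using mr' r gam_pos by (intro divide_left_mono) auto
    then have 2: "\<bar>gam * r / (1 - 2 * (mu * r)) - gam * r\<bar> \<le> S * (gam * (1 / (1 - 2 * mu * S) - 1))"
      using 2 by simp
    have 3: "\<bar>tanh (gam * r) - tanh (r / sqrt 2)\<bar> \<le> S * \<bar>gam - 1 / sqrt 2\<bar>"
      using tanh_real_lipschitz[of "gam * r" "r / sqrt 2"] 1 by linarith
    have 4: "\<bar>tanh (gam * r / (1 - 2 * (mu * r))) - tanh (gam * r)\<bar> \<le> S * (gam * (1 / (1 - 2 * mu * S) - 1))"
      using tanh_real_lipschitz[of "gam * r / (1 - 2 * (mu * r))" "gam * r"] 2 by linarith
    have "E = S * (gam * (1 / (1 - 2 * mu * S) - 1)) + S * \<bar>gam - 1 / sqrt 2\<bar>"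
      by (simp add: E_def distrib_left)
    then show ?thesis using lo up 3 4 by linarith
  qed
  have "\<bar>w (mu * s) - tanh (s / sqrt 2)\<bar> \<le> E"
  proof (cases "0 \<le> s")
    case True
    then show ?thesis using nonneg[of s] s by simp
  next
    case False
    have "mu * - s \<le> mu * S" using s mu_pos by (intro mult_left_mono) auto
    then have "mu * - s \<in> {0..1}" using False S mu_pos by (auto simp: mult_le_0_iff)
    then have "w (mu * - s) = - w (mu * s)" using u1_odd[of "mu * - s"] by (simp add: w_def)
    then show ?thesis using nonneg[of "- s"] s False by (simp add: abs_minus_commute)
  qed
  then have "\<bar>w (mu * s) - tanh (s / sqrt 2)\<bar> / gam \<le> E / gam"
    using gam_pos by (intro divide_right_mono) auto
  moreover have "\<bar>- w (mu * s) / gam - - sqrt 2 * tanh (s / sqrt 2)\<bar>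
      \<le> \<bar>(w (mu * s) - tanh (s / sqrt 2)) / gam\<bar> + \<bar>(1 / gam - sqrt 2) * tanh (s / sqrt 2)\<bar>"
  proof -
    have "- w (mu * s) / gam - - sqrt 2 * tanh (s / sqrt 2) =
        - ((w (mu * s) - tanh (s / sqrt 2)) / gam) - (1 / gam - sqrt 2) * tanh (s / sqrt 2)"
      by (simp add: diff_divide_distrib algebra_simps)
    then show ?thesis by linarith
  qed
  moreover have "\<bar>(1 / gam - sqrt 2) * tanh (s / sqrt 2)\<bar> \<le> \<bar>1 / gam - sqrt 2\<bar> * 1"
    unfolding abs_mult using tanh_real_lt_1[of "s / sqrt 2"] tanh_real_gt_neg1[of "s / sqrt 2"]
    by (intro mult_left_mono) auto
  ultimately show ?thesis
    using gam_pos by (simp add: blowup_error_def E_def[symmetric] abs_divide)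
qed

lemma rescaled_estimate:
  assumes S: "2 * mu * S < 1" and s: "\<bar>s\<bar> \<le> S"
  shows "\<bar>rescaled p v s - profile s\<bar> \<le> S * blowup_error S"
proof -
  define R where "R s = p * (u (mu * s) - M) / M" for s
  have nonneg: "\<bar>R r - profile r\<bar> \<le> S * blowup_error S" if r: "0 \<le> r" "r \<le> S" for r
  proof -
    have est: "\<bar>- w (mu * y) / gam - - sqrt 2 * tanh (y / sqrt 2)\<bar> \<le> blowup_error S" if "y \<in> {0..r}" for y
      using that r by (intro blowup_derivative_estimate S) auto
    have d: "((\<lambda>x. R x - profile x) has_real_derivative
        - w (mu * y) / gam - - sqrt 2 * tanh (y / sqrt 2)) (at y)" for y
      unfolding R_def by (intro DERIV_diff blowup_derivative profile_has_derivative)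
    \<comment> \<open>Both functions vanish at 0, so the derivative estimate integrates to a bound
      with the extra factor S.\<close>
    have "(R r - profile r) - (R 0 - profile 0) \<le> blowup_error S * r - blowup_error S * 0"
      by (rule derivative_mono_imp_le[OF r(1) d DERIV_cmult_Id]) (use est in \<open>force simp: abs_le_iff\<close>)
    moreover have "- (R r - profile r) - - (R 0 - profile 0) \<le> blowup_error S * r - blowup_error S * 0"
      by (rule derivative_mono_imp_le[OF r(1) DERIV_minus[OF d] DERIV_cmult_Id]) (use est in \<open>force simp: abs_le_iff\<close>)
    moreover have "R 0 = 0" "profile 0 = 0" by (simp_all add: R_def M_def profile_eq)
    ultimately have "\<bar>R r - profile r\<bar> \<le> blowup_error S * r" by (simp add: abs_le_iff)
    also have "\<dots> \<le> blowup_error S * S"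
      using order_trans[OF abs_ge_zero est[of 0]] r by (intro mult_left_mono) auto
    finally show ?thesis by (simp add: mult.commute)
  qed
  have ms: "\<bar>mu * s\<bar> \<le> mu * S" using s mu_pos by (simp add: abs_mult)
  have ms': "\<bar>mu * s\<bar> \<le> 1" using ms S by linarith
  then have D: "s \<in> {- 1 / mu..1 / mu}"
    using mu_pos by (auto simp: abs_le_iff field_simps)
  have "mu * s \<in> {-1..1}" using ms' by (simp add: abs_le_iff minus_le_iff)
  then have "R s = R \<bar>s\<bar>"
    using u_even_and_le(1)[of "mu * s"] by (simp add: R_def abs_if)
  moreover have "profile s = profile \<bar>s\<bar>" using profile_minus[of s] by (auto simp: abs_if)
  moreover have "rescaled p v s = R s"
    unfolding R_def using D by (rule rescaled_eq)
  ultimately show ?thesis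
    using nonneg[of "\<bar>s\<bar>"] s by simp
qed

end

section \<open>The limiting Green's function and assembly of the theorem\<close>

lemma twice_green: "2 * green t 0 = 1 - \<bar>t\<bar>"
  by (simp add: green_def field_simps)

lemma islimpt_punctured_interval:
  fixes t :: real
  assumes "t \<in> {-1..1} - {0}"
  shows "t islimpt {-1..1} - {0}"
proof (cases "0 < t")
  case True
  then have "t islimpt {t / 2..1}" using assms by (subst islimpt_Icc) auto
  then show ?thesis by (rule islimpt_subset) (use True in auto)
next
  case False
  then have "t islimpt {-1..t / 2}" using assms by (subst islimpt_Icc) auto
  then show ?thesis by (rule islimpt_subset) (use False assms in auto)
qed

lemma twice_green_has_derivative:
  assumes "t \<noteq> 0"
  shows "((\<lambda>t. 2 * green t 0) has_real_derivative - sgn t) (at t within S)"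
proof -
  have "((\<lambda>t. 2 * green t 0) has_real_derivative - sgn t) (at t)"
  proof (cases "0 < t")
    case True
    show ?thesis
    proof (rule has_field_derivative_transform_within_open)
      show "((\<lambda>t. 1 - t) has_real_derivative - sgn t) (at t)"
        using True by (auto intro!: derivative_eq_intros)
      show "open {0<..<t + 1}" by simp
    qed (use True in \<open>auto simp: twice_green\<close>)
  next
    case False
    then have t: "t < 0" using assms by simp
    show ?thesis
    proof (rule has_field_derivative_transform_within_open)
      show "((\<lambda>t. 1 + t) has_real_derivative - sgn t) (at t)"
        using t by (auto intro!: derivative_eq_intros)
      show "open {t - 1<..<0}" by simp
    qed (use t in \<open>auto simp: twice_green\<close>)
  qed
  then show ?thesis by (rule has_field_derivative_at_within)
qed

lemma C1_on_twice_green: "C1_on ({-1..1} - {0}) (\<lambda>t. 2 * green t 0)"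
proof (rule C1_onI[OF twice_green_has_derivative _ islimpt_punctured_interval])
  show "continuous_on ({-1..1} - {0}) (\<lambda>t::real. - sgn t)"
    by (intro continuous_at_imp_continuous_on ballI continuous_intros) auto
qed auto

lemma profile_C1_on: "C1_on UNIV profile"
  by (rule C1_onI[OF profile_has_derivative DERIV_continuous_on[OF profile_has_second_derivative]]) simp

theorem theorem1p1:
  fixes u :: "real \<Rightarrow> real \<Rightarrow> real" and \<alpha>\<^sub>1 :: "real \<Rightarrow> real"
  assumes "\<And>p. p > 1 \<Longrightarrow> positive_solution p (u p)"
    and "\<And>p. p > 1 \<Longrightarrow> first_dirichlet_eigenvalue (linearized_operator p (u p)) (\<alpha>\<^sub>1 p)"
  shows "((\<lambda>p. sup_norm (u p)) \<longlongrightarrow> 1) at_top \<and>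
    (uniform_limit {-1..1} u (\<lambda>t. 2 * green t 0) at_top \<and>
     C1_loc_tendsto ({-1..1} - {0}) (\<lambda>p. {-1..1}) u (\<lambda>t. 2 * green t 0) at_top) \<and>
    (\<exists>\<epsilon>. (\<epsilon> \<longlongrightarrow> 0) at_top \<and>
         (\<forall>p>1. sup_norm (u p) powr (p + 1) = p / 2 * (1 + \<epsilon> p))) \<and>
    (C1_loc_tendsto UNIV (\<lambda>p. {- 1 / blowup_scale p (u p) .. 1 / blowup_scale p (u p)})
       (\<lambda>p. rescaled p (u p)) profile at_top \<and>
     (\<forall>V. liouville_solution V \<longleftrightarrow> V = profile)) \<and>
    (\<exists>\<epsilon>. (\<epsilon> \<longlongrightarrow> 0) at_top \<and>
         (\<forall>p>1. \<alpha>\<^sub>1 p = - (1 / 4) * p\<^sup>2 * (1 + \<epsilon> p)))"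
proof -
  have "\<exists>U U1. lane_emden p U U1 (u p)" if p: "1 < p" for p
  proof -
    obtain U U1 where U: "\<And>x. (U has_real_derivative U1 x) (at x)"
      "\<And>x. x \<in> {-1..1} \<Longrightarrow> (U1 has_real_derivative - (U x powr p)) (at x)"
      "\<And>x. x \<in> {-1..1} \<Longrightarrow> U x = u p x"
      using positive_solution_C2_extension[OF assms(1)[OF p] p] by blast
    have "lane_emden p U U1 (u p)"
      using assms(1)[OF p] p U
      by unfold_locales (auto simp: positive_solution_def dirichlet_function_def)
    then show ?thesis by blast
  qed
  then obtain U U1 where le: "\<And>p. 1 < p \<Longrightarrow> lane_emden p (U p) (U1 p) (u p)"
    by metis
  \<comment> \<open>The locale constants, each belonging to one p, become functions of p so that
    their limits can be stated.\<close>
  define k where "k p = (p + 1) / 2" for p :: real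
  define M where "M p = lane_emden.M (U p)" for p
  define a where "a p = lane_emden.a p (U p)" for p
  define c where "c p = lane_emden.c p (U p)" for p
  define g where "g p = sqrt (k p / p)" for p
  define \<mu> where "\<mu> p = g p / c p" for p
  have k: "lane_emden.k p = k p" if "1 < p" for p
    using lane_emden.k_def[OF le[OF that]] by (simp add: k_def)
  have gam: "lane_emden.gam p = g p" if "1 < p" for p
    using lane_emden.gam_def[OF le[OF that]] by (simp add: g_def k[OF that])
  have mu: "lane_emden.mu p (U p) = \<mu> p" if "1 < p" for p
    using lane_emden.mu_def[OF le[OF that]] by (simp add: \<mu>_def c_def gam[OF that])
  have k1: "1 < k p" if "1 < p" for p using that by (simp add: k_def)
  have M_pos: "0 < M p" and M_powr: "M p powr (p - 1) = (c p)\<^sup>2 / k p"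
    and a_eq: "a p = M p * (c p / k p)"
    and c_ge: "k p \<le> c p" and c_le: "c p \<le> k p + 1" and sup: "sup_norm (u p) = M p"
    if "1 < p" for p
    using lane_emden.M_pos[OF le[OF that]] lane_emden.M_powr[OF le[OF that]]
      lane_emden.a_eq[OF le[OF that]] lane_emden.c_ge[OF le[OF that]] lane_emden.c_le[OF le[OF that]]
      lane_emden.sup_norm_eq[OF le[OF that]]
    by (simp_all add: M_def a_def c_def k[OF that])
  have large: "\<forall>\<^sub>F p :: real in at_top. 1 < p" by (rule eventually_gt_at_top)

  have ck: "((\<lambda>p. c p / k p) \<longlongrightarrow> 1) at_top"
  proof (rule tendsto_sandwich)
    show "\<forall>\<^sub>F p in at_top. 1 \<le> c p / k p"
      using large by eventually_elim (use c_ge k1 in \<open>force simp: field_simps\<close>)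
    show "\<forall>\<^sub>F p in at_top. c p / k p \<le> 1 + 1 / k p"
      using large by eventually_elim (use c_le k1 in \<open>force simp: field_simps\<close>)
    show "((\<lambda>p. 1 + 1 / k p) \<longlongrightarrow> 1) at_top" unfolding k_def by real_asymp
  qed simp
  have c_top: "filterlim c at_top at_top"
  proof (rule filterlim_at_top_mono)
    show "filterlim k at_top at_top" unfolding k_def by real_asymp
    show "\<forall>\<^sub>F p in at_top. k p \<le> c p" using large by eventually_elim (rule c_ge)
  qed
  \<comment> \<open>M is the (p - 1)-th root of c^2 / k, which lies between k and (k + 1)^2 / k;
    roots of such order of polynomially growing quantities tend to 1.\<close>
  have M1: "(M \<longlongrightarrow> 1) at_top"
  proof (rule tendsto_sandwich)
    have M_eq: "M p = ((c p)\<^sup>2 / k p) powr (1 / (p - 1))" if "1 < p" for p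
      using M_pos[OF that] that by (simp flip: M_powr[OF that] add: powr_powr)
    show "\<forall>\<^sub>F p in at_top. k p powr (1 / (p - 1)) \<le> M p"
      using large
    proof eventually_elim
      case (elim p)
      have "k p * k p \<le> c p * c p" using c_ge[OF elim] k1[OF elim] by (intro mult_mono) auto
      then have "k p \<le> (c p)\<^sup>2 / k p" using k1[OF elim] by (simp add: field_simps power2_eq_square)
      then show ?case unfolding M_eq[OF elim] using k1[OF elim] elim by (intro powr_mono2) auto
    qed
    show "\<forall>\<^sub>F p in at_top. M p \<le> ((k p + 1)\<^sup>2 / k p) powr (1 / (p - 1))"
      using large
    proof eventually_elim
      case (elim p)
      have "(c p)\<^sup>2 / k p \<le> (k p + 1)\<^sup>2 / k p"
        using c_ge[OF elim] c_le[OF elim] k1[OF elim] by (intro divide_right_mono power_mono) auto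
      then show ?case unfolding M_eq[OF elim] using k1[OF elim] elim by (intro powr_mono2) auto
    qed
    show "((\<lambda>p. k p powr (1 / (p - 1))) \<longlongrightarrow> 1) at_top" unfolding k_def by real_asymp
    show "((\<lambda>p. ((k p + 1)\<^sup>2 / k p) powr (1 / (p - 1))) \<longlongrightarrow> 1) at_top"
      unfolding k_def by real_asymp
  qed
  have a1: "(a \<longlongrightarrow> 1) at_top"
  proof (rule Lim_transform_eventually)
    show "((\<lambda>p. M p * (c p / k p)) \<longlongrightarrow> 1) at_top" using tendsto_mult[OF M1 ck] by simp
    show "\<forall>\<^sub>F p in at_top. M p * (c p / k p) = a p"
      using large by eventually_elim (simp add: a_eq)
  qed
  have g_lim: "(g \<longlongrightarrow> 1 / sqrt 2) at_top"
  proof -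
    have "((\<lambda>p. k p / p) \<longlongrightarrow> 1 / 2) at_top" unfolding k_def by real_asymp
    from tendsto_real_sqrt[OF this] show ?thesis by (simp add: g_def[abs_def] real_sqrt_divide)
  qed
  have mu_lim: "(\<mu> \<longlongrightarrow> 0) at_top"
    unfolding \<mu>_def using g_lim c_top by (rule tendsto_divide_0[OF _ filterlim_at_top_imp_at_infinity])

  have part1: "((\<lambda>p. sup_norm (u p)) \<longlongrightarrow> 1) at_top"
    by (rule Lim_transform_eventually[OF M1 eventually_mono[OF large sup[symmetric]]])

  have C0: "uniform_limit {-1..1} u (\<lambda>t. 2 * green t 0) at_top"
  proof (rule uniform_limit_of_bound)
    show "((\<lambda>p. (a p - M p) + \<bar>a p - 1\<bar>) \<longlongrightarrow> 0) at_top"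
      using tendsto_add[OF tendsto_diff[OF a1 M1] tendsto_rabs[OF tendsto_diff[OF a1 tendsto_const[of 1]]]]
      by simp
    show "\<forall>\<^sub>F p in at_top. \<forall>x\<in>{-1..1}. \<bar>u p x - 2 * green x 0\<bar> \<le> (a p - M p) + \<bar>a p - 1\<bar>"
      using large
    proof (eventually_elim, intro ballI)
      fix p x :: real assume p: "1 < p" and x: "x \<in> {-1..1}"
      have "\<bar>u p x - a p * (1 - \<bar>x\<bar>)\<bar> \<le> a p - M p"
        using lane_emden.u_approx[OF le[OF p] x] lane_emden.v[OF le[OF p] x] by (simp add: a_def M_def)
      moreover have "\<bar>(a p - 1) * (1 - \<bar>x\<bar>)\<bar> \<le> \<bar>a p - 1\<bar>"
        unfolding abs_mult using x by (intro mult_left_le) auto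
      \<comment> \<open>The tent of slope a is the intermediate function: one term is controlled by
        a - M, the other by |a - 1|.\<close>
      moreover have "u p x - 2 * green x 0 = (u p x - a p * (1 - \<bar>x\<bar>)) + (a p - 1) * (1 - \<bar>x\<bar>)"
        unfolding twice_green by (simp add: algebra_simps)
      ultimately show "\<bar>u p x - 2 * green x 0\<bar> \<le> (a p - M p) + \<bar>a p - 1\<bar>" by linarith
    qed
  qed

  have C1: "C1_loc_tendsto ({-1..1} - {0}) (\<lambda>p. {-1..1}) u (\<lambda>t. 2 * green t 0) at_top"
    unfolding C1_loc_tendsto_def
  proof (intro conjI allI impI C1_on_twice_green)
    fix K :: "real set" assume K: "compact K \<and> K \<subseteq> {-1..1} - {0}"
    show "\<forall>\<^sub>F p in at_top. K \<subseteq> {-1..1} \<and> C1_on {-1..1} (u p)"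
      using large by eventually_elim (use K lane_emden.solution_C1_on[OF le] in blast)
    show "uniform_limit K u (\<lambda>t. 2 * green t 0) at_top"
      using K by (intro uniform_limit_on_subset[OF C0]) auto
    \<comment> \<open>A compact set missing 0 keeps a positive distance from it; then d c tends to
      infinity and tanh (d c) to 1.\<close>
    obtain d where d: "0 < d" "\<And>x. x \<in> K \<Longrightarrow> d \<le> \<bar>x\<bar>"
      using separate_point_closed[of K 0] K compact_imp_closed[of K] by (auto simp: dist_real_def)
    have tanh1: "((\<lambda>p. tanh (d * c p)) \<longlongrightarrow> 1) at_top"
      by (rule filterlim_compose[OF tanh_real_at_top])
        (rule filterlim_tendsto_pos_mult_at_top[OF tendsto_const d(1) c_top])
    show "uniform_limit K (\<lambda>p t. vector_derivative (u p) (at t within {-1..1}))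
        (\<lambda>t. vector_derivative (\<lambda>t. 2 * green t 0) (at t within {-1..1} - {0})) at_top"
    proof (rule uniform_limit_of_bound)
      show "((\<lambda>p. \<bar>a p - 1\<bar> + a p * (1 - tanh (d * c p))) \<longlongrightarrow> 0) at_top"
        using tendsto_add[OF tendsto_rabs[OF tendsto_diff[OF a1 tendsto_const[of 1]]]
            tendsto_mult[OF a1 tendsto_diff[OF tendsto_const[of 1] tanh1]]]
        by simp
      show "\<forall>\<^sub>F p in at_top. \<forall>t\<in>K. \<bar>vector_derivative (u p) (at t within {-1..1}) -
          vector_derivative (\<lambda>t. 2 * green t 0) (at t within {-1..1} - {0})\<bar>
          \<le> \<bar>a p - 1\<bar> + a p * (1 - tanh (d * c p))"
        using large
      proof (eventually_elim, intro ballI)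
        fix p t :: real assume p: "1 < p" and tK: "t \<in> K"
        then have t: "t \<in> {-1..1} - {0}" "t \<in> {-1..1}" using K by auto
        have "vector_derivative (u p) (at t within {-1..1}) = U1 p t"
          using lane_emden.solution_has_derivative[OF le[OF p] t(2)]
          by (rule vector_derivative_withinI) (use t(2) in \<open>simp add: islimpt_Icc\<close>)
        moreover have "vector_derivative (\<lambda>t. 2 * green t 0) (at t within {-1..1} - {0}) = - sgn t"
          using t by (intro vector_derivative_withinI twice_green_has_derivative islimpt_punctured_interval) auto
        ultimately show "\<bar>vector_derivative (u p) (at t within {-1..1}) -
            vector_derivative (\<lambda>t. 2 * green t 0) (at t within {-1..1} - {0})\<bar>
            \<le> \<bar>a p - 1\<bar> + a p * (1 - tanh (d * c p))"
          using lane_emden.derivative_estimate[OF le[OF p] d(1) d(2)[OF tK] t(2)] by (simp add: a_def c_def)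
      qed
    qed
  qed

  have part3: "\<exists>\<epsilon>. (\<epsilon> \<longlongrightarrow> 0) at_top \<and> (\<forall>p>1. sup_norm (u p) powr (p + 1) = p / 2 * (1 + \<epsilon> p))"
  \<comment> \<open>The witness is the relative error itself, so the identity is immediate for every
    p > 1 and only its limit has content.\<close>
  proof (intro exI[of _ "\<lambda>p. sup_norm (u p) powr (p + 1) / (p / 2) - 1"] conjI allI impI)
    have eq: "(M p)\<^sup>2 * (c p / k p)\<^sup>2 * (k p / (p / 2)) - 1 = sup_norm (u p) powr (p + 1) / (p / 2) - 1"
      if p: "1 < p" for p
    proof -
      have "sup_norm (u p) powr (p + 1) = M p powr (p - 1 + 2)" by (simp add: sup[OF p] add.commute)
      also have "\<dots> = (c p)\<^sup>2 / k p * (M p)\<^sup>2"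
        unfolding powr_add M_powr[OF p] using M_pos[OF p] by (simp add: powr_numeral)
      finally show ?thesis using k1[OF p] by (simp add: power2_eq_square)
    qed
    have "((\<lambda>p. k p / (p / 2)) \<longlongrightarrow> 1) at_top" unfolding k_def by real_asymp
    from tendsto_diff[OF tendsto_mult[OF tendsto_mult[OF tendsto_power[OF M1, of 2]
        tendsto_power[OF ck, of 2]] this] tendsto_const[of 1]]
    have "((\<lambda>p. (M p)\<^sup>2 * (c p / k p)\<^sup>2 * (k p / (p / 2)) - 1) \<longlongrightarrow> 0) at_top"
      by (simp only: power_one mult_1_left diff_self)
    then show "((\<lambda>p. sup_norm (u p) powr (p + 1) / (p / 2) - 1) \<longlongrightarrow> 0) at_top"
      by (rule Lim_transform_eventually) (rule eventually_mono[OF large eq])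
  qed simp

  have scale: "blowup_scale p (u p) = \<mu> p" if "1 < p" for p
    using lane_emden.blowup_scale_eq[OF le[OF that]] by (simp add: mu[OF that])
  define D where "D p = {- 1 / blowup_scale p (u p)..1 / blowup_scale p (u p)}" for p
  have D: "D p = {- 1 / lane_emden.mu p (U p)..1 / lane_emden.mu p (U p)}" if "1 < p" for p
    by (simp add: D_def scale[OF that] mu[OF that])
  have blowup: "C1_loc_tendsto UNIV D (\<lambda>p. rescaled p (u p)) profile at_top"
    unfolding C1_loc_tendsto_def
  proof (intro conjI allI impI profile_C1_on)
    fix K :: "real set" assume K: "compact K \<and> K \<subseteq> UNIV"
    then obtain S where S: "0 < S" "\<And>x. x \<in> K \<Longrightarrow> \<bar>x\<bar> \<le> S"
      using compact_imp_bounded[of K] by (auto simp: bounded_pos)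
    define E where "E p = S * (g p * (1 / (1 - 2 * \<mu> p * S) - 1) + \<bar>g p - 1 / sqrt 2\<bar>) / g p + \<bar>1 / g p - sqrt 2\<bar>" for p
    have E: "lane_emden.blowup_error p (U p) S = E p" if "1 < p" for p
      by (simp add: lane_emden.blowup_error_def[OF le[OF that]] E_def mu[OF that] gam[OF that])
    have E0: "(E \<longlongrightarrow> 0) at_top"
    proof -
      have "(E \<longlongrightarrow> S * (1 / sqrt 2 * (1 / (1 - 2 * 0 * S) - 1) + \<bar>1 / sqrt 2 - 1 / sqrt 2\<bar>) / (1 / sqrt 2)
          + \<bar>1 / (1 / sqrt 2) - sqrt 2\<bar>) at_top"
        unfolding E_def by (intro tendsto_intros mu_lim g_lim) simp_all
      then show ?thesis by simp
    qed
    have "((\<lambda>p. 2 * \<mu> p * S) \<longlongrightarrow> 0) at_top"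
      using tendsto_mult[OF tendsto_mult[OF tendsto_const[of 2] mu_lim] tendsto_const[of S]] by simp
    from eventually_conj[OF large order_tendstoD(2)[OF this zero_less_one]]
    have small: "\<forall>\<^sub>F p in at_top. 1 < p \<and> 2 * \<mu> p * S < 1" .
    have inD: "x \<in> D p" if "1 < p" "2 * \<mu> p * S < 1" "x \<in> K" for p x
    proof -
      have mp: "0 < \<mu> p" using lane_emden.mu_pos[OF le] mu that by metis
      have "\<bar>\<mu> p * x\<bar> \<le> \<mu> p * S" using S(2)[OF that(3)] mp by (simp add: abs_mult)
      then have "\<bar>\<mu> p * x\<bar> \<le> 1" using that(2) by linarith
      then show ?thesis using mp that(1) by (auto simp: D mu abs_le_iff field_simps)
    qed
    show "\<forall>\<^sub>F p in at_top. K \<subseteq> D p \<and> C1_on (D p) (rescaled p (u p))"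
      using small
    proof eventually_elim
      case (elim p)
      then have p: "1 < p" by simp
      show ?case
      proof
        show "K \<subseteq> D p" using inD elim by blast
        show "C1_on (D p) (rescaled p (u p))"
          unfolding D[OF p] by (rule lane_emden.rescaled_C1_on[OF le[OF p]])
      qed
    qed
    show "uniform_limit K (\<lambda>p. rescaled p (u p)) profile at_top"
    proof (rule uniform_limit_of_bound)
      show "((\<lambda>p. S * E p) \<longlongrightarrow> 0) at_top" using tendsto_mult_left[OF E0, of S] by simp
      show "\<forall>\<^sub>F p in at_top. \<forall>x\<in>K. \<bar>rescaled p (u p) x - profile x\<bar> \<le> S * E p"
        using small
      proof (eventually_elim, intro ballI)
        fix p x assume p: "1 < p \<and> 2 * \<mu> p * S < 1" and x: "x \<in> K"
        then have p1: "1 < p" by simp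
        show "\<bar>rescaled p (u p) x - profile x\<bar> \<le> S * E p"
          using lane_emden.rescaled_estimate[OF le[OF p1] _ S(2)[OF x]] p
          by (simp add: mu[OF p1] E[OF p1])
      qed
    qed
    show "uniform_limit K (\<lambda>p t. vector_derivative (rescaled p (u p)) (at t within D p))
        (\<lambda>t. vector_derivative profile (at t)) at_top"
    proof (rule uniform_limit_of_bound[OF E0])
      show "\<forall>\<^sub>F p in at_top. \<forall>t\<in>K. \<bar>vector_derivative (rescaled p (u p)) (at t within D p) -
          vector_derivative profile (at t)\<bar> \<le> E p"
        using small
      proof (eventually_elim, intro ballI)
        fix p t assume p: "1 < p \<and> 2 * \<mu> p * S < 1" and t: "t \<in> K"
        then have p1: "1 < p" by simp
        have tD: "t \<in> {- 1 / lane_emden.mu p (U p)..1 / lane_emden.mu p (U p)}"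
          using inD[of p t] p t D[OF p1] by simp
        have 1: "vector_derivative (rescaled p (u p)) (at t within D p) =
            - lane_emden.w p (U p) (U1 p) (lane_emden.mu p (U p) * t) / lane_emden.gam p"
          unfolding D[OF p1]
          using lane_emden.rescaled_has_derivative[OF le[OF p1] tD]
            lane_emden.islimpt_blowup_domain[OF le[OF p1] tD]
          by (rule vector_derivative_withinI)
        have 2: "vector_derivative profile (at t) = - sqrt 2 * tanh (t / sqrt 2)"
          using profile_has_derivative by (rule vector_derivative_withinI) simp
        show "\<bar>vector_derivative (rescaled p (u p)) (at t within D p) -
            vector_derivative profile (at t)\<bar> \<le> E p"
          unfolding 1 2 E[OF p1, symmetric]
          by (rule lane_emden.blowup_derivative_estimate[OF le[OF p1] _ S(2)[OF t]])
            (use p mu[OF p1] in simp)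
      qed
    qed
  qed

  have part5: "\<exists>\<epsilon>. (\<epsilon> \<longlongrightarrow> 0) at_top \<and> (\<forall>p>1. \<alpha>\<^sub>1 p = - (1 / 4) * p\<^sup>2 * (1 + \<epsilon> p))"
  proof (intro exI[of _ "\<lambda>p. - \<alpha>\<^sub>1 p / (p\<^sup>2 / 4) - 1"] conjI allI impI)
    \<comment> \<open>The lower bound holds for every eigenvalue; the upper one uses minimality
      against the eigenvalue found by shooting. Both are asymptotic to -c^2, and c ~ k ~
      p/2.\<close>
    have bounds: "- ((c p)\<^sup>2 * (1 + 2 / k p)) \<le> \<alpha>\<^sub>1 p" "\<alpha>\<^sub>1 p \<le> - ((k p - 1) * ((c p)\<^sup>2 / k p))"
      if p: "1 < p" for p
    proof -
      have eig: "dirichlet_eigenvalue (linearized_operator p (u p)) (\<alpha>\<^sub>1 p)"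
        and least: "\<And>\<beta>. dirichlet_eigenvalue (linearized_operator p (u p)) \<beta> \<Longrightarrow> \<alpha>\<^sub>1 p \<le> \<beta>"
        using assms(2)[OF p] by (auto simp: first_dirichlet_eigenvalue_def)
      show "- ((c p)\<^sup>2 * (1 + 2 / k p)) \<le> \<alpha>\<^sub>1 p"
        using lane_emden.eigenvalue_ge[OF le[OF p] eig] by (simp add: c_def k[OF p])
      show "\<alpha>\<^sub>1 p \<le> - ((k p - 1) * ((c p)\<^sup>2 / k p))"
        using lane_emden.exists_eigenvalue_le[OF le[OF p]] least
        by (force simp: c_def k[OF p])
    qed
    have "((\<lambda>p. - \<alpha>\<^sub>1 p / (p\<^sup>2 / 4)) \<longlongrightarrow> 1) at_top"
    proof (rule tendsto_sandwich)
      show "\<forall>\<^sub>F p in at_top. (c p / k p)\<^sup>2 * ((k p - 1) * k p / (p\<^sup>2 / 4)) \<le> - \<alpha>\<^sub>1 p / (p\<^sup>2 / 4)"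
        using large
      proof eventually_elim
        case (elim p)
        have "(k p - 1) * ((c p)\<^sup>2 / k p) / (p\<^sup>2 / 4) \<le> - \<alpha>\<^sub>1 p / (p\<^sup>2 / 4)"
          using bounds(2)[OF elim] by (intro divide_right_mono) auto
        also have "(k p - 1) * ((c p)\<^sup>2 / k p) / (p\<^sup>2 / 4) = (c p / k p)\<^sup>2 * ((k p - 1) * k p / (p\<^sup>2 / 4))"
          using k1[OF elim] elim by (simp add: field_simps power2_eq_square)
        finally show ?case .
      qed
      show "\<forall>\<^sub>F p in at_top. - \<alpha>\<^sub>1 p / (p\<^sup>2 / 4) \<le> (c p / k p)\<^sup>2 * ((k p)\<^sup>2 * (1 + 2 / k p) / (p\<^sup>2 / 4))"
        using large
      proof eventually_elim
        case (elim p)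
        have "- \<alpha>\<^sub>1 p / (p\<^sup>2 / 4) \<le> (c p)\<^sup>2 * (1 + 2 / k p) / (p\<^sup>2 / 4)"
          using bounds(1)[OF elim] by (intro divide_right_mono) auto
        also have "\<dots> = (c p / k p)\<^sup>2 * ((k p)\<^sup>2 * (1 + 2 / k p) / (p\<^sup>2 / 4))"
          using k1[OF elim] elim by (simp only: power_divide) (simp add: field_simps)
        finally show ?case .
      qed
      have "((\<lambda>p. (k p - 1) * k p / (p\<^sup>2 / 4)) \<longlongrightarrow> 1) at_top" unfolding k_def by real_asymp
      from tendsto_mult[OF tendsto_power[OF ck, of 2] this]
      show "((\<lambda>p. (c p / k p)\<^sup>2 * ((k p - 1) * k p / (p\<^sup>2 / 4))) \<longlongrightarrow> 1) at_top"
        by (simp only: power_one mult_1_left)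
      have "((\<lambda>p. (k p)\<^sup>2 * (1 + 2 / k p) / (p\<^sup>2 / 4)) \<longlongrightarrow> 1) at_top" unfolding k_def by real_asymp (simp add: power2_eq_square)
      from tendsto_mult[OF tendsto_power[OF ck, of 2] this]
      show "((\<lambda>p. (c p / k p)\<^sup>2 * ((k p)\<^sup>2 * (1 + 2 / k p) / (p\<^sup>2 / 4))) \<longlongrightarrow> 1) at_top"
        by (simp only: power_one mult_1_left)
    qed
    from tendsto_diff[OF this tendsto_const[of 1]]
    show "((\<lambda>p. - \<alpha>\<^sub>1 p / (p\<^sup>2 / 4) - 1) \<longlongrightarrow> 0) at_top"
      by (simp only: diff_self)
  qed simp

  show ?thesis
    using part1 C0 C1 part3 blowup part5 liouville_solution_iff unfolding D_def by blast
qed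

end
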